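(* Let $a,n$ be integers with $1<a<n$. Let $T'_n,T''_n$ be two independent copies of the uniformly random unrooted binary tree with leaf-set $[n]$, and let $X_{n,a}$ be the random total number of leaf-sets $S\subset[n]$ of cardinality $a$ that induce the same rooted subtree in $T'_n$ and in $T''_n$. Then $$\mathbb E[X_{n,a}]=\frac{\binom{n}{a}}{(2a-3)!!}.$$ Equivalently: for every $S\subset[n]$ with $|S|=a$ and every rooted binary tree $\mathcal T$ with leaf-set $S$, the number $\mathcal N(\mathcal T)$ of unrooted binary trees $T$ on leaf-set $[n]$ in which $S$ induces $\mathcal T$ equals $$\mathcal N(\mathcal T)=\frac{(2n-5)!!}{(2a-3)!!}.$$
   Context: $[n]=\{1,\dots,n\}$; $(2k-1)!!=1\cdot3\cdots(2k-1)$, $(-1)!!=1$. An unrooted binary tree with leaf-set $[n]$ is a tree whose leaves (degree-1 vertices) are labelled bijectively by $[n]$ and all of whose other vertices have degree 3; trees are considered up to isomorphism preserving leaf labels, and there are $(2n-5)!!$ of them for $n\ge3$. A rooted binary tree with leaf-set $S$ is a rooted tree whose leaves are labelled bijectively by $S$ and in which every non-leaf vertex has exactly two (unordered) children; such trees are considered up to isomorphism preserving the root and leaf labels, and there are $(2|S|-3)!!$ of them for $|S|\ge 2$. Rooted subtree induced by $S$ in an unrooted tree $T$ on $[n]$, where $1<|S|<n$: for each $S$ a leaf $\ell^*\in[n]\setminus S$ is fixed (an arbitrary choice, depending on $S$ only, the same for all trees $T$). Let $v$ be the vertex of $T$ adjacent to $\ell^*$. The paths from the leaves of $S$ to $v$,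 traced toward $v$, have a first common vertex $v^*$ (the first vertex lying on all $|S|$ of these paths). The union of the paths from $v^*$ to the leaves in $S$, rooted at $v^*$, with all its degree-2 vertices other than the root suppressed, is a rooted binary tree with leaf-set $S$, called the (rooted) tree induced by $S$ in $T$. *)

theory Defs
  imports "HOL-Probability.Probability" "Graph_Theory.Graph_Theory"
begin

fun double_fact :: "nat \<Rightarrow> nat" where
  "double_fact 0 = 1"
| "double_fact (Suc 0) = 1"
| "double_fact (Suc (Suc m)) = Suc (Suc m) * double_fact m"


section \<open>Trees as undirected graphs\<close>

text \<open>
  Graphs are symmetric loop-free digraphs on vertices of type \<^typ>\<open>nat\<close>. A leaf is identified with
  its label, so a tree with leaf-set \<open>S\<close> has the elements of \<open>S\<close> themselves as leaves; the other
  vertices are arbitrary naturals outside \<open>S\<close>. Since there are infinitely many of those, every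
  finite leaf-labelled tree has an isomorphic copy of this form.

  The library's \<open>tree\<close> cannot be used here: in a symmetric digraph every edge yields a closed
  walk \<open>u, v, u\<close>, which counts as a directed cycle. Cycles of an undirected graph are
  those of length at least 3.
\<close>

definition undirected_tree :: "nat pair_pre_digraph \<Rightarrow> bool" where
  "undirected_tree G \<longleftrightarrow>
     pair_graph G \<and> Digraph_Component.connected (with_proj G) \<and>
     \<not> (\<exists>p. pre_digraph.cycle (with_proj G) p \<and> 3 \<le> length p)"

definition tree_path :: "nat pair_pre_digraph \<Rightarrow> nat \<Rightarrow> nat \<Rightarrow> (nat \<times> nat) list" where
  "tree_path G u v = (THE p. pre_digraph.apath (with_proj G) u p v)"

definition tree_path_verts :: "nat pair_pre_digraph \<Rightarrow> nat \<Rightarrow> nat \<Rightarrow> nat list" where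
  "tree_path_verts G u v = pawalk_verts u (tree_path G u v)"

definition iso_fixing ::
  "nat set \<Rightarrow> nat pair_pre_digraph \<Rightarrow> nat pair_pre_digraph
     \<Rightarrow> (nat, nat \<times> nat, nat, nat \<times> nat) digraph_isomorphism \<Rightarrow> bool" where
  "iso_fixing L G H h \<longleftrightarrow>
     pre_digraph.digraph_isomorphism (with_proj G) h \<and> with_proj H = app_iso h (with_proj G) \<and>
     (\<forall>x\<in>L. iso_verts h x = x)"


section \<open>Unrooted binary trees\<close>

definition unrooted_binary_trees :: "nat \<Rightarrow> nat pair_pre_digraph set" where
  "unrooted_binary_trees n =
     {G. undirected_tree G \<and>
         {v \<in> pverts G. out_degree (with_proj G) v = 1} = {1..n} \<and>
         (\<forall>v \<in> pverts G - {1..n}. out_degree (with_proj G) v = 3)}"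

definition unrooted_iso :: "nat \<Rightarrow> nat pair_pre_digraph rel" where
  "unrooted_iso n =
     {(G, H). G \<in> unrooted_binary_trees n \<and> H \<in> unrooted_binary_trees n \<and>
              (\<exists>h. iso_fixing {1..n} G H h)}"

definition unrooted_classes :: "nat \<Rightarrow> nat pair_pre_digraph set set" where
  "unrooted_classes n = unrooted_binary_trees n // unrooted_iso n"


section \<open>Rooted binary trees\<close>

type_synonym rooted_graph = "nat pair_pre_digraph \<times> nat"

definition children :: "nat pair_pre_digraph \<Rightarrow> nat \<Rightarrow> nat \<Rightarrow> nat set" where
  "children G r v = {w. (v, w) \<in> parcs G \<and> v \<in> set (tree_path_verts G r w)}"

definition rooted_binary_trees :: "nat set \<Rightarrow> rooted_graph set" where
  "rooted_binary_trees S =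
     {(G, r). undirected_tree G \<and> r \<in> pverts G \<and>
              {v \<in> pverts G. children G r v = {}} = S \<and>
              (\<forall>v \<in> pverts G - S. card (children G r v) = 2)}"

definition rooted_iso :: "nat set \<Rightarrow> rooted_graph rel" where
  "rooted_iso S =
     {((G, r), (H, q)). (G, r) \<in> rooted_binary_trees S \<and> (H, q) \<in> rooted_binary_trees S \<and>
                        (\<exists>h. iso_fixing S G H h \<and> iso_verts h r = q)}"

definition rooted_classes :: "nat set \<Rightarrow> rooted_graph set set" where
  "rooted_classes S = rooted_binary_trees S // rooted_iso S"


section \<open>The rooted tree induced by a set of leaves\<close>

definition attach_vertex :: "nat pair_pre_digraph \<Rightarrow> nat \<Rightarrow> nat" where
  "attach_vertex G l = (THE v. (l, v) \<in> parcs G)"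

definition first_common_vertex :: "nat pair_pre_digraph \<Rightarrow> nat set \<Rightarrow> nat \<Rightarrow> nat" where
  "first_common_vertex G S v =
     (THE w. \<forall>s\<in>S. find (\<lambda>x. \<forall>t\<in>S. x \<in> set (tree_path_verts G t v)) (tree_path_verts G s v)
                   = Some w)"

definition path_union :: "nat pair_pre_digraph \<Rightarrow> nat \<Rightarrow> nat set \<Rightarrow> nat pair_pre_digraph" where
  "path_union G r S =
     \<lparr> pverts = (\<Union>s\<in>S. set (tree_path_verts G r s)),
       parcs = (\<Union>s\<in>S. set (tree_path G r s) \<union> (set (tree_path G r s))\<inverse>) \<rparr>"

text \<open>
  \<^const>\<open>gen_contr_graph\<close> keeps the given vertices and joins two of them iff there is a path between
  them with no inner vertex among those kept.
\<close>

definition suppress_degree_2 :: "nat pair_pre_digraph \<Rightarrow> nat \<Rightarrow> nat pair_pre_digraph" where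
  "suppress_degree_2 H r =
     gen_contr_graph (with_proj H) {v \<in> pverts H. v = r \<or> out_degree (with_proj H) v \<noteq> 2}"

text \<open>Here \<open>l\<close> is the leaf outside \<open>S\<close> that was fixed for \<open>S\<close>.\<close>

definition induced_tree :: "nat \<Rightarrow> nat set \<Rightarrow> nat pair_pre_digraph \<Rightarrow> rooted_graph" where
  "induced_tree l S G =
     (let r = first_common_vertex G S (attach_vertex G l)
      in (suppress_degree_2 (path_union G r S) r, r))"

text \<open>The lifting to isomorphism classes: a union over representatives of equal classes.\<close>

definition induced_class :: "nat \<Rightarrow> nat set \<Rightarrow> nat pair_pre_digraph set \<Rightarrow> rooted_graph set" where
  "induced_class l S T = (\<Union>G\<in>T. rooted_iso S `` {induced_tree l S G})"


section \<open>Two independent uniformly random trees\<close>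

definition num_common_subtrees ::
  "(nat set \<Rightarrow> nat) \<Rightarrow> nat \<Rightarrow> nat
     \<Rightarrow> nat pair_pre_digraph set \<Rightarrow> nat pair_pre_digraph set \<Rightarrow> nat" where
  "num_common_subtrees ls n a T' T'' =
     card {S. S \<subseteq> {1..n} \<and> card S = a \<and> induced_class (ls S) S T' = induced_class (ls S) S T''}"

text \<open>
  \<^const>\<open>pmf_of_set\<close> is the uniform distribution because there are finitely many, and at
  least one, isomorphism classes; \<^const>\<open>pair_pmf\<close> is the product distribution.
\<close>

definition random_tree_pair ::
  "nat \<Rightarrow> (nat pair_pre_digraph set \<times> nat pair_pre_digraph set) pmf" where
  "random_tree_pair n =
     pair_pmf (pmf_of_set (unrooted_classes n)) (pmf_of_set (unrooted_classes n))"

end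

theory Submission
  imports Defs "HOL-Library.Sublist"
begin

text \<open>
  A leaf-labelled binary tree is determined by its clusters, the sets of leaves below its vertices.
  For a rooted binary tree with leaf set \<open>A\<close> the clusters form a binary hierarchy on \<open>A\<close>: a laminar
  family that contains \<open>A\<close> and all singletons and in which every larger cluster is a disjoint union
  of two others. An unrooted binary tree with leaf set \<open>{1..n}\<close>, hung from one of its leaves \<open>l\<close>,
  yields in the same way a binary hierarchy on \<open>{1..n} - {l}\<close>. Trees are isomorphic exactly if their
  hierarchies agree (\<open>rooted_iso_iff\<close>, \<open>unrooted_iso_iff\<close>), and every hierarchy on \<open>{1..n} - {l}\<close> comes
  from an unrooted tree (\<open>unrooted_clusters_surj\<close>).

  Let \<open>l\<close> be the leaf that is fixed for \<open>S\<close>. Then taking the induced tree means intersecting with \<open>S\<close>: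
  the clusters of the tree induced by \<open>S\<close> are the nonempty sets \<open>C \<inter> S\<close>, where \<open>C\<close> runs through the
  clusters of the tree hung from \<open>l\<close> (\<open>induced_tree_clusters\<close>). So the unrooted trees that induce a
  given rooted tree on \<open>S\<close> correspond to the hierarchies on the \<open>n - 1\<close> leaves other than \<open>l\<close> that
  restrict to a given hierarchy on \<open>S\<close>.

  These are counted by inserting leaves one at a time. A hierarchy on \<open>k\<close> leaves has \<open>2 * k - 1\<close>
  clusters, and a new leaf can be made the sibling of any of them; every hierarchy on \<open>k + 1\<close> leaves
  that restricts to the given one arises in this way exactly once (\<open>bij_betw_insert_leaf\<close>). With
  \<open>a = card S\<close>, the number of extensions is therefore the product of the numbers \<open>2 * k - 1\<close> for
  \<open>a \<le> k < n - 1\<close>, which is the claimed quotient of double factorials (\<open>card_hierarchy_extensions\<close>).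
  Starting from a single leaf one gets the total number of unrooted trees. The expectation follows
  by linearity: whatever the first tree is, the second one induces the same tree on \<open>S\<close> with
  probability \<open>1 / double_fact (2 * a - 3)\<close>.

  The link between graphs and clusters is the ancestor order. A finite undirected tree with a chosen
  root is the Hasse graph of its ancestor order (\<open>hasse_graph_ancestor_order\<close>), and every finite order
  with a top element in which upper sets of points are chains is the ancestor order of its Hasse
  graph (\<open>undirected_tree_hasse\<close>, \<open>ancestor_order_hasse\<close>). Paths towards the root and back become
  intervals of the order (\<open>tree_path_up\<close>, \<open>tree_path_down\<close>), and suppressing degree-2 vertices
  becomes passing to a suborder (\<open>gen_contr_graph_hasse\<close>).
\<close>

section \<open>Binary hierarchies\<close>

text \<open>
  These are the families of leaf sets below the vertices of a rooted binary tree with leaf set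
  \<open>A\<close>. For finite \<open>A \<noteq> {}\<close> they are the maximal laminar families of nonempty subsets of \<open>A\<close>.
\<close>

definition binary_hierarchy :: "'a set \<Rightarrow> 'a set set \<Rightarrow> bool" where
  "binary_hierarchy A H \<longleftrightarrow>
     H \<subseteq> Pow A \<and> {} \<notin> H \<and> A \<in> H \<and> (\<forall>x\<in>A. {x} \<in> H) \<and>
     (\<forall>C\<in>H. \<forall>D\<in>H. C \<subseteq> D \<or> D \<subseteq> C \<or> C \<inter> D = {}) \<and>
     (\<forall>C\<in>H. (\<exists>x. C = {x}) \<or> (\<exists>D\<in>H. \<exists>E\<in>H. D \<inter> E = {} \<and> C = D \<union> E))"

lemma binary_hierarchyD:
  assumes "binary_hierarchy A H"
  shows "C \<in> H \<Longrightarrow> C \<subseteq> A" "C \<in> H \<Longrightarrow> C \<noteq> {}" "A \<in> H" "x \<in> A \<Longrightarrow> {x} \<in> H"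
    and "C \<in> H \<Longrightarrow> D \<in> H \<Longrightarrow> C \<subseteq> D \<or> D \<subseteq> C \<or> C \<inter> D = {}"
  using assms unfolding binary_hierarchy_def by (elim conjE; auto)+

lemma binary_hierarchy_split:
  assumes "binary_hierarchy A H" "C \<in> H" "\<nexists>x. C = {x}"
  shows "\<exists>D\<in>H. \<exists>E\<in>H. D \<inter> E = {} \<and> C = D \<union> E"
  using assms by (auto simp: binary_hierarchy_def)

lemma finite_binary_hierarchy: "finite A \<Longrightarrow> binary_hierarchy A H \<Longrightarrow> finite H"
  by (rule finite_subset[of H "Pow A"]) (auto simp: binary_hierarchy_def)

lemma finite_binary_hierarchies: "finite A \<Longrightarrow> finite {H. binary_hierarchy A H}"
  by (rule finite_subset[of _ "Pow (Pow A)"]) (auto simp: binary_hierarchy_def)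

lemma binary_hierarchy_singleton: "binary_hierarchy {x} H \<longleftrightarrow> H = {{x}}"
proof
  assume h: "binary_hierarchy {x} H"
  have "C = {x}" if "C \<in> H" for C
    using binary_hierarchyD(1,2)[OF h that] by blast
  then show "H = {{x}}" using binary_hierarchyD(3)[OF h] by blast
qed (auto simp: binary_hierarchy_def)

section \<open>Restricting a hierarchy to fewer leaves\<close>

lemma obtain_minimal_set:
  assumes "finite {C. P C}" "P C0"
  obtains C where "P C" "\<And>D. P D \<Longrightarrow> D \<subseteq> C \<Longrightarrow> D = C"
proof -
  obtain C where "C \<in> {C. P C}" "\<forall>D\<in>{C. P C}. D \<subseteq> C \<longrightarrow> C = D"
    using finite_has_minimal[of "{C. P C}"] assms by blast
  then show thesis by (intro that[of C]) auto
qed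

definition restrict_hierarchy :: "'a set \<Rightarrow> 'a set set \<Rightarrow> 'a set set" where
  "restrict_hierarchy S H = (\<lambda>C. C \<inter> S) ` H - {{}}"

lemma restrict_hierarchyI: "C \<in> H \<Longrightarrow> C \<inter> S \<noteq> {} \<Longrightarrow> C \<inter> S \<in> restrict_hierarchy S H"
  by (simp add: restrict_hierarchy_def)

lemma restrict_hierarchyE:
  assumes "D \<in> restrict_hierarchy S H"
  obtains C where "C \<in> H" "D = C \<inter> S" "D \<noteq> {}"
  using assms unfolding restrict_hierarchy_def by blast

lemma restrict_hierarchy_restrict:
  "S \<subseteq> A \<Longrightarrow> restrict_hierarchy S (restrict_hierarchy A H) = restrict_hierarchy S H"
proof -
  assume "S \<subseteq> A"
  then have *: "C \<inter> A \<inter> S = C \<inter> S" for C by blast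
  show ?thesis
  proof (intro set_eqI iffI)
    fix D assume "D \<in> restrict_hierarchy S (restrict_hierarchy A H)"
    then show "D \<in> restrict_hierarchy S H" using * by (auto simp: restrict_hierarchy_def)
  next
    fix D assume "D \<in> restrict_hierarchy S H"
    then obtain C where "C \<in> H" "D = C \<inter> S" "D \<noteq> {}" by (rule restrict_hierarchyE)
    then have "C \<inter> A \<in> restrict_hierarchy A H" "D = C \<inter> A \<inter> S"
      using * by (auto simp: restrict_hierarchy_def)
    then show "D \<in> restrict_hierarchy S (restrict_hierarchy A H)"
      using \<open>D \<noteq> {}\<close> unfolding restrict_hierarchy_def by blast
  qed
qed

lemma restrict_hierarchy_self:
  assumes "binary_hierarchy A H"
  shows "restrict_hierarchy A H = H"
proof -
  have "(\<lambda>C. C \<inter> A) ` H = id ` H"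
    by (rule image_cong) (use binary_hierarchyD(1)[OF assms] in auto)
  then show ?thesis
    using assms by (auto simp: restrict_hierarchy_def binary_hierarchy_def)
qed

text \<open>
  Among the clusters with a given trace on \<open>S\<close> the smallest one splits into two halves that both
  meet \<open>S\<close>: if one of them missed \<open>S\<close>, the other would be a smaller cluster with the same trace.
\<close>

lemma binary_hierarchy_restrict:
  assumes h: "binary_hierarchy A H" and S: "S \<subseteq> A" "S \<noteq> {}" and fin: "finite A"
  shows "binary_hierarchy S (restrict_hierarchy S H)"
  unfolding binary_hierarchy_def
proof (intro conjI ballI)
  show "restrict_hierarchy S H \<subseteq> Pow S" "{} \<notin> restrict_hierarchy S H"
    by (auto simp: restrict_hierarchy_def)
  show "S \<in> restrict_hierarchy S H"
    using binary_hierarchyD(3)[OF h] S by (auto simp: restrict_hierarchy_def image_iff)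
  show "{x} \<in> restrict_hierarchy S H" if "x \<in> S" for x
    using binary_hierarchyD(4)[OF h, of x] S that
    by (force simp: restrict_hierarchy_def image_iff)
  show "C \<subseteq> D \<or> D \<subseteq> C \<or> C \<inter> D = {}"
    if C: "C \<in> restrict_hierarchy S H" and D: "D \<in> restrict_hierarchy S H" for C D
  proof -
    obtain C' where "C' \<in> H" "C = C' \<inter> S" using C by (rule restrict_hierarchyE)
    moreover obtain D' where "D' \<in> H" "D = D' \<inter> S" using D by (rule restrict_hierarchyE)
    ultimately show ?thesis using binary_hierarchyD(5)[OF h, of C' D'] by blast
  qed
  show "(\<exists>x. C = {x}) \<or> (\<exists>D\<in>restrict_hierarchy S H. \<exists>E\<in>restrict_hierarchy S H. D \<inter> E = {} \<and> C = D \<union> E)"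
    if C: "C \<in> restrict_hierarchy S H" for C
  proof (cases "\<exists>x. C = {x}")
    case False
    let ?P = "\<lambda>C'. C' \<in> H \<and> C' \<inter> S = C"
    obtain C0 where C0: "?P C0" using C by (auto elim: restrict_hierarchyE)
    have "finite {C'. ?P C'}"
      using finite_binary_hierarchy[OF fin h] by (rule rev_finite_subset) auto
    then obtain C' where C': "?P C'" and least: "\<And>D. ?P D \<Longrightarrow> D \<subseteq> C' \<Longrightarrow> D = C'"
      using C0 by (rule obtain_minimal_set) blast
    have "\<nexists>x. C' = {x}"
      using C' False C by (auto simp: restrict_hierarchy_def)
    then obtain D E where DE: "D \<in> H" "E \<in> H" "D \<inter> E = {}" "C' = D \<union> E"
      using binary_hierarchy_split[OF h, of C'] C' by blast
    have "D \<inter> S \<noteq> {}"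
      using least[of E] DE C' binary_hierarchyD(2)[OF h \<open>D \<in> H\<close>] by blast
    moreover have "E \<inter> S \<noteq> {}"
      using least[of D] DE C' binary_hierarchyD(2)[OF h \<open>E \<in> H\<close>] by blast
    ultimately have "D \<inter> S \<in> restrict_hierarchy S H" "E \<inter> S \<in> restrict_hierarchy S H"
      using DE by (auto simp: restrict_hierarchy_def)
    moreover have "(D \<inter> S) \<inter> (E \<inter> S) = {}" "C = (D \<inter> S) \<union> (E \<inter> S)" using DE C' by auto
    ultimately show ?thesis by blast
  qed simp
qed

section \<open>Inserting a leaf into a hierarchy\<close>

text \<open>
  The new leaf \<open>x\<close> is attached to the edge above the cluster \<open>C\<close> and becomes the sibling of \<open>C\<close>.
  The clusters strictly above \<open>C\<close> absorb \<open>x\<close>, whereas \<open>C\<close> itself stays and gets the parent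
  \<open>insert x C\<close>.
\<close>

definition insert_leaf :: "'a \<Rightarrow> 'a set \<Rightarrow> 'a set set \<Rightarrow> 'a set set" where
  "insert_leaf x C H = {D \<in> H. \<not> C \<subset> D} \<union> insert x ` {D \<in> H. C \<subseteq> D} \<union> {{x}}"

lemma insert_leaf_cases:
  assumes "F \<in> insert_leaf x C H"
  obtains "F \<in> H" "\<not> C \<subset> F" | D where "D \<in> H" "C \<subseteq> D" "F = insert x D" | "F = {x}"
  using assms by (auto simp: insert_leaf_def)

lemma binary_hierarchy_insert_leaf:
  assumes h: "binary_hierarchy A H" and x: "x \<notin> A" and C: "C \<in> H"
  shows "binary_hierarchy (insert x A) (insert_leaf x C H)"
  unfolding binary_hierarchy_def
proof (intro conjI ballI)
  note hD = binary_hierarchyD[OF h]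
  show "insert_leaf x C H \<subseteq> Pow (insert x A)" "{} \<notin> insert_leaf x C H"
    using hD(1,2) by (auto simp: insert_leaf_def)
  show "insert x A \<in> insert_leaf x C H"
    using hD(1)[OF C] hD(3) by (auto simp: insert_leaf_def)
  show "{y} \<in> insert_leaf x C H" if "y \<in> insert x A" for y
    using that hD(4)[of y] hD(2)[OF C] by (auto simp: insert_leaf_def)
  show "F \<subseteq> G \<or> G \<subseteq> F \<or> F \<inter> G = {}"
    if F: "F \<in> insert_leaf x C H" and G: "G \<in> insert_leaf x C H" for F G
  proof -
    have notin: "x \<notin> D" if "D \<in> H" for D using hD(1)[OF that] x by blast
    have mixed: "D \<subseteq> insert x E \<or> insert x E \<subseteq> D \<or> D \<inter> insert x E = {}"
      if "D \<in> H" "\<not> C \<subset> D" "E \<in> H" "C \<subseteq> E" for D E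
      using hD(5)[of D E] that notin[of D] by blast
    show ?thesis
      using F
    proof (cases rule: insert_leaf_cases)
      case F1: 1
      show ?thesis using G
        by (cases rule: insert_leaf_cases)
          (use F1 hD(5)[of F G] mixed[of F] notin[of F] in auto)
    next
      case F2: (2 D)
      show ?thesis using G
      proof (cases rule: insert_leaf_cases)
        case 1 then show ?thesis using mixed[of G D] F2 by blast
      next
        case (2 E)
        then show ?thesis using hD(5)[of D E] hD(2)[OF C] F2 by blast
      qed (use F2 in auto)
    next
      case 3
      then show ?thesis by blast
    qed
  qed
  show "(\<exists>y. F = {y}) \<or> (\<exists>D\<in>insert_leaf x C H. \<exists>E\<in>insert_leaf x C H. D \<inter> E = {} \<and> F = D \<union> E)"
    if F: "F \<in> insert_leaf x C H" for F
    using F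
  proof (cases rule: insert_leaf_cases)
    case 1
    show ?thesis
    proof (cases "\<exists>y. F = {y}")
      case False
      then obtain D E where "D \<in> H" "E \<in> H" "D \<inter> E = {}" "F = D \<union> E"
        using binary_hierarchy_split[OF h \<open>F \<in> H\<close>] by blast
      moreover have "\<not> C \<subset> D" "\<not> C \<subset> E" using 1 \<open>F = D \<union> E\<close> by auto
      ultimately show ?thesis unfolding insert_leaf_def by blast
    qed simp
  next
    case (2 G)
    show ?thesis
    proof (cases "C = G")
      case True
      then have "C \<in> insert_leaf x C H" "{x} \<in> insert_leaf x C H" using C by (auto simp: insert_leaf_def)
      moreover have "C \<inter> {x} = {}" "F = C \<union> {x}" using 2 True hD(1)[OF C] x by auto
      ultimately show ?thesis by blast
    next
      case False
      then have sub: "C \<subset> G" using 2 by auto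
      then have "\<nexists>y. G = {y}" using hD(2)[OF C] by auto
      then obtain D E where DE: "D \<in> H" "E \<in> H" "D \<inter> E = {}" "G = D \<union> E"
        using binary_hierarchy_split[OF h \<open>G \<in> H\<close>] by blast
      have ne: "D \<noteq> {}" "E \<noteq> {}" "C \<noteq> {}" using DE hD(2) C by auto
      have cases: "C \<subseteq> D \<or> C \<subseteq> E"
        using hD(5)[OF C DE(1)] hD(5)[OF C DE(2)] sub DE ne by blast
      have larger: ?thesis
        if "D' \<in> H" "E' \<in> H" "D' \<inter> E' = {}" "G = D' \<union> E'" "C \<subseteq> D'" for D' E'
      proof -
        have "\<not> C \<subset> E'" using that ne by blast
        then have "insert x D' \<in> insert_leaf x C H" "E' \<in> insert_leaf x C H"
          using that by (auto simp: insert_leaf_def)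
        moreover have "insert x D' \<inter> E' = {}" "F = insert x D' \<union> E'"
          using that 2 hD(1)[OF \<open>E' \<in> H\<close>] x by auto
        ultimately show ?thesis by blast
      qed
      have "E \<inter> D = {}" "G = E \<union> D" using DE by auto
      then show ?thesis using cases larger[OF DE] larger[OF DE(2,1)] by blast
    qed
  qed simp
qed

lemma restrict_insert_leaf:
  assumes h: "binary_hierarchy A H" and x: "x \<notin> A" and C: "C \<in> H"
  shows "restrict_hierarchy A (insert_leaf x C H) = H"
proof -
  have trace: "D \<inter> A = D" "insert x D \<inter> A = D" "D \<noteq> {}" if "D \<in> H" for D
    using binary_hierarchyD(1,2)[OF h that] x by auto
  have "D \<in> H" if D: "D \<in> restrict_hierarchy A (insert_leaf x C H)" for D
  proof -
    obtain F where F: "F \<in> insert_leaf x C H" "D = F \<inter> A" "D \<noteq> {}"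
      using D by (rule restrict_hierarchyE)
    from F(1) show ?thesis
      by (cases rule: insert_leaf_cases) (use F x trace in auto)
  qed
  moreover have "D \<in> restrict_hierarchy A (insert_leaf x C H)" if D: "D \<in> H" for D
  proof -
    have "D \<in> insert_leaf x C H \<or> insert x D \<in> insert_leaf x C H"
      using D unfolding insert_leaf_def by blast
    then show ?thesis
      using trace[OF D] restrict_hierarchyI[of D "insert_leaf x C H" A]
        restrict_hierarchyI[of "insert x D" "insert_leaf x C H" A] by auto
  qed
  ultimately show ?thesis by blast
qed

text \<open>
  The place of attachment can be read off from the result: \<open>insert x C\<close> is the smallest cluster
  other than \<open>{x}\<close> that contains \<open>x\<close>.
\<close>

lemma inj_on_insert_leaf:
  assumes h: "binary_hierarchy A H" and x: "x \<notin> A"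
  shows "inj_on (\<lambda>C. insert_leaf x C H) H"
proof -
  have notin: "x \<notin> D" if "D \<in> H" for D using binary_hierarchyD(1)[OF h that] x by blast
  have sub: "D \<subseteq> C" if "C \<in> H" "D \<in> H" "insert_leaf x C H = insert_leaf x D H" for C D
  proof -
    have "insert x C \<in> insert_leaf x C H" using that(1) unfolding insert_leaf_def by blast
    then have "insert x C \<in> insert_leaf x D H" unfolding that(3) .
    then show ?thesis
      using notin[OF \<open>C \<in> H\<close>] binary_hierarchyD(2)[OF h \<open>C \<in> H\<close>]
    proof (cases rule: insert_leaf_cases)
      case (2 E)
      then have "C = E" using notin[OF \<open>C \<in> H\<close>] notin[OF \<open>E \<in> H\<close>] by (simp add: insert_ident)
      then show ?thesis using 2 by simp
    qed (use notin in auto)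
  qed
  show ?thesis
  proof (rule inj_onI)
    fix C D assume *: "C \<in> H" "D \<in> H" "insert_leaf x C H = insert_leaf x D H"
    show "C = D" using sub[OF *] sub[OF *(2,1) *(3)[symmetric]] by (rule subset_antisym[rotated])
  qed
qed

text \<open>
  The smallest cluster that contains \<open>x\<close> together with another leaf splits into \<open>{x}\<close> and the
  place of attachment \<open>C\<close>.
\<close>

lemma binary_hierarchy_is_insert_leaf:
  assumes h: "binary_hierarchy (insert x A) H'" and x: "x \<notin> A" and A: "A \<noteq> {}" "finite A"
  shows "\<exists>C\<in>restrict_hierarchy A H'. H' = insert_leaf x C (restrict_hierarchy A H')"
proof -
  note hD = binary_hierarchyD[OF h]
  let ?P = "\<lambda>C. C \<in> H' \<and> x \<in> C \<and> C \<noteq> {x}"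
  have "finite {C. ?P C}"
    using finite_binary_hierarchy[OF _ h] A by simp
  moreover have "?P (insert x A)" using hD(3) A x by auto
  ultimately obtain C' where C': "?P C'" and least: "\<And>D. ?P D \<Longrightarrow> D \<subseteq> C' \<Longrightarrow> D = C'"
    by (rule obtain_minimal_set) blast
  have above: "C' \<subseteq> F" if "F \<in> H'" "x \<in> F" "F \<noteq> {x}" for F
    using hD(5)[of C' F] C' that least[of F] by blast
  obtain D E where DE: "D \<in> H'" "E \<in> H'" "D \<inter> E = {}" "C' = D \<union> E"
    using binary_hierarchy_split[OF h, of C'] C' by blast
  have "C' - {x} \<in> H'"
  proof (cases "x \<in> D")
    case True
    then have "D = {x}" using least[of D] DE hD(2)[of E] by blast
    then have "C' - {x} = E" using DE by blast
    then show ?thesis using DE by simp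
  next
    case False
    then have "E = {x}" using least[of E] DE hD(2)[of D] C' by blast
    then show ?thesis using DE False by (simp add: insert_Diff_if)
  qed
  moreover define C where "C = C' - {x}"
  ultimately have C: "C \<in> H'" "x \<notin> C" "C' = insert x C" "C \<noteq> {}" using C' hD(2) by auto
  have CA: "C \<subseteq> A" using hD(1)[OF C(1)] C by blast
  let ?H = "restrict_hierarchy A H'"
  have "C \<in> ?H" using C CA by (auto simp: restrict_hierarchy_def image_iff intro!: bexI[of _ C])
  moreover have "F \<in> insert_leaf x C ?H" if F: "F \<in> H'" for F
  proof (cases "x \<in> F")
    case True
    show ?thesis
    proof (cases "F = {x}")
      case False
      then have "C \<subseteq> F \<inter> A" using above[OF F True] C CA by blast
      moreover have "F \<inter> A \<in> ?H" using calculation F C by (auto simp: restrict_hierarchy_def)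
      moreover have "F = insert x (F \<inter> A)" using hD(1)[OF F] True by blast
      ultimately show ?thesis unfolding insert_leaf_def by blast
    qed (simp add: insert_leaf_def)
  next
    case False
    then have "F \<inter> A = F" using hD(1)[OF F] by blast
    then have "F \<in> ?H" using F hD(2)[OF F] by (force simp: restrict_hierarchy_def)
    moreover have "\<not> C \<subset> F"
      using hD(5)[of F C'] F False C' C by blast
    ultimately show ?thesis by (simp add: insert_leaf_def)
  qed
  moreover have "F \<in> H'" if "F \<in> insert_leaf x C ?H" for F
    using that
  proof (cases rule: insert_leaf_cases)
    case 1
    then obtain G where G: "G \<in> H'" "F = G \<inter> A" "F \<noteq> {}" by (blast elim: restrict_hierarchyE)
    show ?thesis
    proof (cases "x \<in> G")
      case True
      then have "C' \<subseteq> G" using above G x by blast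
      then have "F = C" using 1 G C CA by blast
      then show ?thesis using C by simp
    next
      case False
      then have "F = G" using G hD(1)[of G] by blast
      then show ?thesis using G by simp
    qed
  next
    case (2 D)
    then obtain G where G: "G \<in> H'" "D = G \<inter> A" by (blast elim: restrict_hierarchyE)
    show ?thesis
    proof (cases "x \<in> G")
      case True
      then have "F = G" using G 2 hD(1)[of G] by blast
      then show ?thesis using G by simp
    next
      case False
      then have "D = G" using G hD(1)[of G] by blast
      then have "G \<subseteq> C'" using hD(5)[of G C'] G C' C 2 False by blast
      then have "F = C'" using 2 \<open>D = G\<close> C False by blast
      then show ?thesis using C' by simp
    qed
  next
    case 3 then show ?thesis using hD(4) by simp
  qed
  ultimately show ?thesis by blast
qed

lemma card_insert_leaf:
  assumes h: "binary_hierarchy A H" and x: "x \<notin> A" and C: "C \<in> H" and A: "finite A"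
  shows "card (insert_leaf x C H) = card H + 2"
proof -
  have fin: "finite H" using finite_binary_hierarchy[OF A h] .
  have notin: "x \<notin> D" "D \<noteq> {}" if "D \<in> H" for D using binary_hierarchyD(1,2)[OF h that] x by blast+
  let ?K = "{D \<in> H. C \<subset> D}"
  have inj: "card (insert x ` {D \<in> H. C \<subseteq> D}) = card {D \<in> H. C \<subseteq> D}"
    by (rule card_image) (use notin in \<open>auto simp: inj_on_def insert_ident\<close>)
  have "{D \<in> H. C \<subseteq> D} = insert C ?K" using C by auto
  then have 2: "card (insert x ` {D \<in> H. C \<subseteq> D}) = card ?K + 1" using fin inj by simp
  have "{D \<in> H. \<not> C \<subset> D} = H - ?K" by auto
  then have 1: "card {D \<in> H. \<not> C \<subset> D} = card H - card ?K" using fin by (simp add: card_Diff_subset)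
  have 0: "card ?K \<le> card H" using fin by (auto intro: card_mono)
  have "card (insert_leaf x C H) =
    card {D \<in> H. \<not> C \<subset> D} + card (insert x ` {D \<in> H. C \<subseteq> D}) + card {{x}}"
    unfolding insert_leaf_def
    by (subst card_Un_disjoint, use fin notin in auto)+
  then show ?thesis using 0 1 2 by simp
qed

lemma card_binary_hierarchy:
  assumes "finite A" "A \<noteq> {}" "binary_hierarchy A H"
  shows "card H = 2 * card A - 1"
  using assms
proof (induction A arbitrary: H rule: finite_ne_induct)
  case (singleton x)
  then show ?case by (simp add: binary_hierarchy_singleton)
next
  case (insert x A)
  let ?H = "restrict_hierarchy A H"
  have h: "binary_hierarchy A ?H"
    using binary_hierarchy_restrict[OF insert.prems] insert by auto
  obtain C where C: "C \<in> ?H" "H = insert_leaf x C ?H"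
    using binary_hierarchy_is_insert_leaf[OF insert.prems insert.hyps(3,2,1)] by blast
  have "card H = card ?H + 2"
    using card_insert_leaf[OF h insert.hyps(3) C(1) insert.hyps(1)] C(2) by simp
  then show ?case using insert.IH[OF h] insert by (simp add: card_gt_0_iff Suc_leI)
qed

lemma bij_betw_insert_leaf:
  assumes h: "binary_hierarchy A H" and x: "x \<notin> A" and A: "A \<noteq> {}" "finite A"
  shows "bij_betw (\<lambda>C. insert_leaf x C H) H
           {H'. binary_hierarchy (insert x A) H' \<and> restrict_hierarchy A H' = H}"
  unfolding bij_betw_def
proof (intro conjI)
  show "(\<lambda>C. insert_leaf x C H) ` H =
      {H'. binary_hierarchy (insert x A) H' \<and> restrict_hierarchy A H' = H}"
    using binary_hierarchy_insert_leaf[OF h x] restrict_insert_leaf[OF h x]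
      binary_hierarchy_is_insert_leaf[OF _ x A] by blast
qed (rule inj_on_insert_leaf[OF h x])

section \<open>Counting hierarchies\<close>

text \<open>
  For \<open>k = 1\<close> the truncated difference \<open>2 * k - 3\<close> is \<open>0\<close>, and \<open>double_fact 0 = 1\<close> stands in for
  the double factorial of \<open>-1\<close>.
\<close>

lemma double_fact_step:
  assumes "0 < k"
  shows "double_fact (2 * Suc k - 3) = (2 * k - 1) * double_fact (2 * k - 3)"
proof (cases "k = 1")
  case False
  then have "2 * Suc k - 3 = Suc (Suc (2 * k - 3))" "2 * k - 1 = Suc (Suc (2 * k - 3))"
    using assms by auto
  then show ?thesis by (simp only: double_fact.simps)
qed simp

text \<open>
  The leaves of \<open>A - S\<close> are inserted one after the other. A hierarchy on \<open>k\<close> leaves has \<open>2 * k - 1\<close>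
  clusters, and each of them is a place for the next leaf, so the number of choices at each step
  does not depend on the earlier ones and the total is a quotient of double factorials.
\<close>

theorem card_hierarchy_extensions:
  assumes A: "finite A" and S: "S \<subseteq> A" "S \<noteq> {}" and h: "binary_hierarchy S h"
  shows "card {H. binary_hierarchy A H \<and> restrict_hierarchy S H = h} * double_fact (2 * card S - 3)
           = double_fact (2 * card A - 3)"
proof -
  have finS: "finite S" using A S(1) by (rule rev_finite_subset)
  have "card {H. binary_hierarchy (S \<union> B) H \<and> restrict_hierarchy S H = h} * double_fact (2 * card S - 3)
           = double_fact (2 * card (S \<union> B) - 3)" if "finite B" "B \<inter> S = {}" for B
    using that
  proof (induction B)
    case empty
    have "{H. binary_hierarchy (S \<union> {}) H \<and> restrict_hierarchy S H = h} = {h}"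
      using h by (auto simp: restrict_hierarchy_self)
    then show ?case by simp
  next
    case (insert x B)
    let ?A = "S \<union> B"
    have x: "x \<notin> ?A" and ne: "?A \<noteq> {}" and fin: "finite ?A" using insert S finS by auto
    let ?X = "\<lambda>A. {H. binary_hierarchy A H \<and> restrict_hierarchy S H = h}"
    let ?Y = "\<lambda>H. {H'. binary_hierarchy (insert x ?A) H' \<and> restrict_hierarchy ?A H' = H}"
    have "?X (insert x ?A) = (\<Union>H\<in>?X ?A. ?Y H)"
    proof -
      have "binary_hierarchy ?A (restrict_hierarchy ?A H')" if "binary_hierarchy (insert x ?A) H'" for H'
        using binary_hierarchy_restrict[OF that _ ne] fin by auto
      then show ?thesis using restrict_hierarchy_restrict[of S ?A] by auto
    qed
    also have "card \<dots> = (\<Sum>H\<in>?X ?A. card (?Y H))"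
    proof (rule card_UN_disjoint)
      show "finite (?X ?A)" using finite_binary_hierarchies[OF fin] by simp
      show "\<forall>H\<in>?X ?A. finite (?Y H)"
        using finite_binary_hierarchies[of "insert x ?A"] fin by simp
    qed auto
    also have "\<dots> = (\<Sum>H\<in>?X ?A. 2 * card ?A - 1)"
    proof (rule sum.cong[OF refl])
      fix H assume "H \<in> ?X ?A"
      then have H: "binary_hierarchy ?A H" by simp
      show "card (?Y H) = 2 * card ?A - 1"
        using bij_betw_same_card[OF bij_betw_insert_leaf[OF H x ne fin]]
          card_binary_hierarchy[OF fin ne H] by simp
    qed
    finally have *: "card (?X (insert x ?A)) = card (?X ?A) * (2 * card ?A - 1)" by simp
    have "0 < card ?A" using fin ne card_gt_0_iff by blast
    then have "double_fact (2 * card (insert x ?A) - 3) = (2 * card ?A - 1) * double_fact (2 * card ?A - 3)"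
      unfolding card_insert_disjoint[OF fin x] by (rule double_fact_step)
    also have "\<dots> = (2 * card ?A - 1) * (card (?X ?A) * double_fact (2 * card S - 3))"
      using insert by auto
    finally show ?case using * by (simp add: ac_simps)
  qed
  from this[of "A - S"] A S show ?thesis
    by (simp add: Un_absorb1 Diff_disjoint Int_commute)
qed

text \<open>
  A single leaf carries only one hierarchy, so every hierarchy on \<open>A\<close> extends it.
\<close>

corollary card_binary_hierarchies:
  assumes A: "finite A" "A \<noteq> {}"
  shows "card {H. binary_hierarchy A H} = double_fact (2 * card A - 3)"
proof -
  obtain x where x: "x \<in> A" using A by blast
  have "restrict_hierarchy {x} H = {{x}}" if "binary_hierarchy A H" for H
    using binary_hierarchy_restrict[OF that, of "{x}"] x A by (simp add: binary_hierarchy_singleton)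
  then have "{H. binary_hierarchy A H \<and> restrict_hierarchy {x} H = {{x}}} = {H. binary_hierarchy A H}"
    by blast
  then show ?thesis
    using card_hierarchy_extensions[OF A(1), of "{x}" "{{x}}"] x
    by (simp add: binary_hierarchy_singleton)
qed

section \<open>Paths in undirected trees\<close>

lemma undirected_treeD:
  assumes "undirected_tree G"
  shows "pair_graph G" "Digraph_Component.connected (with_proj G)"
    "pre_digraph.cycle (with_proj G) p \<Longrightarrow> length p < 3"
  using assms by (force simp: undirected_tree_def)+

lemma tree_apath_unique:
  assumes T: "undirected_tree G"
    and "pre_digraph.apath (with_proj G) u p v" "pre_digraph.apath (with_proj G) u q v"
  shows "p = q"
proof -
  interpret pair_graph G using T by (rule undirected_treeD)
  show ?thesis
    using assms(2,3)
  proof (induction p arbitrary: u q)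
    case Nil
    then show ?case using apath_nonempty_ends[of u q v] by (auto simp: apath_Nil_iff)
  next
    case (Cons e p')
    from Cons.prems have "q \<noteq> []"
      using apath_nonempty_ends[of u "e # p'" v] by (auto simp: apath_Nil_iff)
    then obtain f q' where q: "q = f # q'" by (cases q) auto
    obtain x where e: "e = (u, x)" and ux: "(u, x) \<in> parcs G"
      and p': "apath x p' v" and u_p': "u \<notin> set (awalk_verts x p')"
      using Cons.prems by (cases e) (auto simp: apath_Cons_iff)
    obtain y where f: "f = (u, y)" and uy: "(u, y) \<in> parcs G"
      and q': "apath y q' v" and u_q': "u \<notin> set (awalk_verts y q')"
      using Cons.prems(2) unfolding q by (cases f) (auto simp: apath_Cons_iff)
    show ?case
    proof (cases "x = y")
      case True
      then show ?thesis using Cons.IH[OF p'] q' q e f by simp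
    next
      case False
      \<comment> \<open>The two continuations join \<open>x\<close> to \<open>y\<close> without meeting \<open>u\<close>. As \<open>x \<noteq> y\<close>, the arcs between
        \<open>u\<close> and these two vertices close a cycle of length at least 3.\<close>
      have w: "awalk x p' v" "awalk y q' v" using p' q' by (auto intro: awalkI_apath)
      have rq: "awalk v (rev_path q') y" using w(2) by simp
      have walk: "awalk x (p' @ rev_path q') y" using w(1) rq by (rule awalk_appendI)
      have "u \<notin> set (awalk_verts x (p' @ rev_path q'))"
        using set_awalk_verts_append[OF w(1) rq] awalk_verts_rev_path[OF w(2)] u_p' u_q' by simp
      moreover define s where "s = awalk_to_apath (p' @ rev_path q')"
      have s: "apath x s y" unfolding s_def using walk by (rule apath_awalk_to_apath)
      have "set (awalk_verts x s) \<subseteq> set (awalk_verts x (p' @ rev_path q'))"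
        using awalk_to_apath_subset[OF walk] set_awalk_verts[OF walk] set_awalk_verts[OF awalkI_apath[OF s]]
        by (auto simp: s_def)
      ultimately have u_s: "u \<notin> set (awalk_verts x s)" by blast
      have "s \<noteq> []" using s False by (auto simp: apath_Nil_iff)
      let ?c = "(u, x) # s @ [(y, u)]"
      have "awalk x (s @ [(y, u)]) u"
        using s arcs_symmetric[OF uy] in_arcsD1[OF ux]
        by (auto simp: apath_def awalk_simps)
      moreover have "awalk_verts x (s @ [(y, u)]) = awalk_verts x s @ [u]"
        using calculation s awlast_of_awalk[of x s y] by (subst awalk_verts_append) (auto simp: apath_def)
      ultimately have "cycle ?c"
        using s u_s ux unfolding cycle_def
        by (intro exI[of _ u]) (auto simp: awalk_Cons_iff apath_def)
      then show ?thesis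
        using undirected_treeD(3)[OF T] \<open>s \<noteq> []\<close> by (cases s) force+
    qed
  qed
qed

lemma tree_apath_exists:
  assumes T: "undirected_tree G" and "u \<in> pverts G" "v \<in> pverts G"
  shows "\<exists>p. pre_digraph.apath (with_proj G) u p v"
proof -
  interpret pair_graph G using T by (rule undirected_treeD)
  have "strongly_connected (with_proj G)"
    using symmetric_connected_imp_strongly_connected undirected_treeD(2)[OF T] sym_arcs by blast
  then show ?thesis
    using assms(2,3) reachable_apath[of u v] strongly_connectedE by auto
qed

lemma tree_path_eq:
  assumes "undirected_tree G" "pre_digraph.apath (with_proj G) u p v"
  shows "tree_path G u v = p"
  unfolding tree_path_def using assms tree_apath_unique by blast

lemma apath_tree_path:
  assumes "undirected_tree G" "u \<in> pverts G" "v \<in> pverts G"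
  shows "pre_digraph.apath (with_proj G) u (tree_path G u v) v"
  using tree_apath_exists[OF assms] tree_path_eq[OF assms(1)] by metis

section \<open>Tree orders\<close>

definition covers :: "('a \<Rightarrow> 'a \<Rightarrow> bool) \<Rightarrow> 'a \<Rightarrow> 'a \<Rightarrow> bool" where
  "covers le x y \<longleftrightarrow> le x y \<and> x \<noteq> y \<and> (\<forall>z. le x z \<longrightarrow> le z y \<longrightarrow> z = x \<or> z = y)"

definition hasse_graph :: "'a set \<Rightarrow> ('a \<Rightarrow> 'a \<Rightarrow> bool) \<Rightarrow> 'a pair_pre_digraph" where
  "hasse_graph V le = \<lparr> pverts = V, parcs = {(x, y). covers le x y \<or> covers le y x} \<rparr>"

lemma hasse_graph_simps [simp]:
  "pverts (hasse_graph V le) = V"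
  "(x, y) \<in> parcs (hasse_graph V le) \<longleftrightarrow> covers le x y \<or> covers le y x"
  by (auto simp: hasse_graph_def)

text \<open>
  The relation \<open>le x y\<close> says that \<open>y\<close> is an ancestor of \<open>x\<close> or \<open>x\<close> itself. It is confined to \<open>V\<close>,
  so that two tree orders on the same vertices can be compared as functions.
\<close>

locale tree_order =
  fixes V :: "nat set" and r :: nat and le :: "nat \<Rightarrow> nat \<Rightarrow> bool"
  assumes finite_V: "finite V"
    and root_in: "r \<in> V"
    and le_in: "le x y \<Longrightarrow> x \<in> V \<and> y \<in> V"
    and le_refl: "x \<in> V \<Longrightarrow> le x x"
    and le_antisym: "le x y \<Longrightarrow> le y x \<Longrightarrow> x = y"
    and le_trans: "le x y \<Longrightarrow> le y z \<Longrightarrow> le x z"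
    and le_root: "x \<in> V \<Longrightarrow> le x r"
    and le_chain: "le x y \<Longrightarrow> le x z \<Longrightarrow> le y z \<or> le z y"
begin

lemma coversD: "covers le x y \<Longrightarrow> le x y" "covers le x y \<Longrightarrow> x \<noteq> y"
  by (auto simp: covers_def)

text \<open>
  The ancestors of \<open>x\<close> form a chain, whose least element above \<open>x\<close> is the parent \<open>y\<close>.
\<close>

lemma covers_below: "covers le x y \<Longrightarrow> le x a \<Longrightarrow> x \<noteq> a \<Longrightarrow> le y a"
  unfolding covers_def using le_chain le_refl le_in by metis

lemma covers_unique: "covers le x y \<Longrightarrow> covers le x z \<Longrightarrow> y = z"
  using covers_below coversD le_antisym by metis

lemma finite_down: "finite {z. le z y}" and finite_up: "finite {z. le y z}"
  by (rule finite_subset[OF _ finite_V], use le_in in blast)+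

lemma card_down_less: "le x y \<Longrightarrow> x \<noteq> y \<Longrightarrow> card {z. le z x} < card {z. le z y}"
  by (intro psubset_card_mono finite_down) (use le_trans le_refl le_in le_antisym in blast)

lemma card_up_less: "le x y \<Longrightarrow> x \<noteq> y \<Longrightarrow> card {z. le y z} < card {z. le x z}"
  by (intro psubset_card_mono finite_up) (use le_trans le_refl le_in le_antisym in blast)

lemma parent_exists:
  assumes "le x a" "x \<noteq> a"
  shows "\<exists>y. covers le x y \<and> le y a"
proof -
  obtain y where y: "le x y" "x \<noteq> y" "le y a"
    and least: "\<And>z. le x z \<and> x \<noteq> z \<and> le z a \<Longrightarrow> card {u. le u y} \<le> card {u. le u z}"
    using ex_has_least_nat[of "\<lambda>y. le x y \<and> x \<noteq> y \<and> le y a" a "\<lambda>y. card {u. le u y}"]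
      assms le_refl le_in by blast
  have "z = x \<or> z = y" if "le x z" "le z y" for z
    using least[of z] card_down_less[of z y] that y le_trans by (metis linorder_not_less)
  then show ?thesis using y unfolding covers_def by blast
qed

lemma child_exists:
  assumes "le x a" "x \<noteq> a"
  shows "\<exists>y. covers le y a \<and> le x y"
proof -
  obtain y where y: "le y a" "y \<noteq> a" "le x y"
    and least: "\<And>z. le z a \<and> z \<noteq> a \<and> le x z \<Longrightarrow> card {u. le y u} \<le> card {u. le z u}"
    using ex_has_least_nat[of "\<lambda>y. le y a \<and> y \<noteq> a \<and> le x y" x "\<lambda>y. card {u. le y u}"]
      assms le_refl le_in by blast
  have "z = y \<or> z = a" if "le y z" "le z a" for z
    using least[of z] card_up_less[of y z] that y le_trans by (metis linorder_not_less)
  then show ?thesis using y unfolding covers_def by blast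
qed

lemma up_induct [consumes 1, case_names top step]:
  assumes "le x a" and "P a" and "\<And>x y. covers le x y \<Longrightarrow> le y a \<Longrightarrow> P y \<Longrightarrow> P x"
  shows "P x"
  using assms(1)
proof (induction "card {z. le x z}" arbitrary: x rule: less_induct)
  case less
  show ?case
  proof (cases "x = a")
    case False
    then obtain y where y: "covers le x y" "le y a" using parent_exists less.prems by blast
    then show ?thesis using less.hyps[of y] card_up_less[of x y] coversD[OF y(1)] assms(3)[OF y] by simp
  qed (use assms(2) in simp)
qed

lemma pair_graph_hasse: "pair_graph (hasse_graph V le)"
proof
  show "finite (parcs (hasse_graph V le))"
    by (rule finite_subset[of _ "V \<times> V"]) (use finite_V le_in in \<open>auto simp: hasse_graph_def covers_def\<close>)
  show "symmetric (with_proj (hasse_graph V le))"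
    unfolding symmetric_def by (rule symI) auto
qed (use finite_V le_in in \<open>auto simp: covers_def\<close>)

text \<open>
  The order in which the upward path visits its vertices serves to find the first common vertex of
  several such paths, its arcs serve to describe their union.
\<close>

lemma up_path_exists:
  assumes "le x a"
  shows "\<exists>p. pre_digraph.apath (with_proj (hasse_graph V le)) x p a \<and>
           sorted_wrt (\<lambda>y z. le y z \<and> y \<noteq> z) (pawalk_verts x p) \<and>
           set (pawalk_verts x p) = {y. le x y \<and> le y a} \<and>
           set p = {(y, z). covers le y z \<and> le x y \<and> le z a}"
proof -
  interpret G: pair_graph "hasse_graph V le" by (rule pair_graph_hasse)
  show ?thesis
    using assms
  proof (induction rule: up_induct)
    case top
    have "a \<in> V" using assms le_in by blast
    then show ?case
      by (intro exI[of _ "[]"])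
        (auto simp: G.apath_Nil_iff le_refl dest: le_antisym coversD le_trans)
  next
    case (step x y)
    then obtain p where p: "G.apath y p a" "sorted_wrt (\<lambda>y z. le y z \<and> y \<noteq> z) (pawalk_verts y p)"
      "set (pawalk_verts y p) = {z. le y z \<and> le z a}"
      "set p = {(w, z). covers le w z \<and> le y w \<and> le z a}" by auto
    have xy: "le x y" "x \<noteq> y" using coversD[OF step(1)] .
    have notle: "\<not> le y x" using xy le_antisym by blast
    have xa: "le x a" using xy(1) step(2) by (rule le_trans)
    have up: "le x z \<longleftrightarrow> z = x \<or> le y z" for z
      using covers_below[OF step(1)] xy le_trans le_refl le_in by blast
    have "G.apath x ((x, y) # p) a"
      using step(1) p(1,3) notle by (simp add: G.apath_Cons_iff)
    moreover have "sorted_wrt (\<lambda>y z. le y z \<and> y \<noteq> z) (pawalk_verts x ((x, y) # p))"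
      using p(2,3) notle up by auto
    moreover have "set (pawalk_verts x ((x, y) # p)) = {z. le x z \<and> le z a}"
    proof -
      have "set (pawalk_verts x ((x, y) # p)) = insert x {z. le y z \<and> le z a}" using p(3) by simp
      also have "\<dots> = {z. le x z \<and> le z a}" using up xa by blast
      finally show ?thesis .
    qed
    moreover have "set ((x, y) # p) = {(w, z). covers le w z \<and> le x w \<and> le z a}"
    proof -
      have "set ((x, y) # p) = insert (x, y) {(w, z). covers le w z \<and> le y w \<and> le z a}"
        using p(4) by simp
      also have "\<dots> = {(w, z). covers le w z \<and> le x w \<and> le z a}"
      proof (rule set_eqI)
        fix e :: "nat \<times> nat"
        obtain w z where "e = (w, z)" by (cases e)
        then show "e \<in> insert (x, y) {(w, z). covers le w z \<and> le y w \<and> le z a} \<longleftrightarrow>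
            e \<in> {(w, z). covers le w z \<and> le x w \<and> le z a}"
          using up[of w] step(1,2) covers_unique[of x y z] by auto
      qed
      finally show ?thesis .
    qed
    ultimately show ?case by blast
  qed
qed

text \<open>
  A walk leaves the part of the tree below \<open>x\<close> only through \<open>x\<close>, because the only neighbour of a
  vertex strictly below \<open>x\<close> that is not below that vertex is its parent, which is still below \<open>x\<close>.
\<close>

lemma walk_leaves_through:
  assumes "pre_digraph.awalk (with_proj (hasse_graph V le)) y p b" "le y x" "\<not> le b x"
  shows "x \<in> set (pawalk_verts y p)"
proof -
  interpret G: pair_graph "hasse_graph V le" by (rule pair_graph_hasse)
  show ?thesis
    using assms
  proof (induction p arbitrary: y)
    case (Cons e p)
    then obtain y' where e: "e = (y, y')" "covers le y y' \<or> covers le y' y" "G.awalk y' p b"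
      by (cases e) (auto simp: G.awalk_Cons_iff)
    show ?case
    proof (cases "y = x")
      case False
      then have "le y' x" using e(2) Cons.prems covers_below coversD le_trans by blast
      then show ?thesis using Cons.IH[OF e(3)] Cons.prems e by simp
    qed (simp add: e)
  qed (auto simp: G.awalk_Nil_iff)
qed

text \<open>
  A cycle through the arc from \<open>u\<close> to \<open>v\<close> contains a path from \<open>v\<close> back to \<open>u\<close>. One of the two
  vertices is the parent of the other, and the only path between a vertex and its parent is the arc
  itself, so the cycle has length 2.
\<close>

lemma undirected_tree_hasse: "undirected_tree (hasse_graph V le)"
proof -
  interpret G: pair_graph "hasse_graph V le" by (rule pair_graph_hasse)
  let ?G = "with_proj (hasse_graph V le)"
  have reach: "x \<rightarrow>\<^sup>*\<^bsub>?G\<^esub> r" if "x \<in> V" for x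
    using up_path_exists[OF le_root[OF that]] by (auto simp: G.reachable_awalk G.apath_def)
  have "Digraph_Component.connected ?G"
  proof (rule G.connectedI)
    show "pverts (hasse_graph V le) \<noteq> {}" using root_in by auto
    fix u v assume "u \<in> pverts (hasse_graph V le)" "v \<in> pverts (hasse_graph V le)"
    then have "u \<rightarrow>\<^sup>*\<^bsub>?G\<^esub> r" "v \<rightarrow>\<^sup>*\<^bsub>?G\<^esub> r" using reach by auto
    then have "u \<rightarrow>\<^sup>*\<^bsub>?G\<^esub> v" using G.symmetric_reachable' G.reachable_trans by blast
    then show "u \<rightarrow>\<^sup>*\<^bsub>with_proj (mk_symmetric ?G)\<^esub> v"
      using G.reachable_mk_symmetric_eq[OF G.sym_arcs] by simp
  qed
  moreover have "length c < 3" if c: "G.cycle c" for c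
  proof -
    \<comment> \<open>A path from \<open>v\<close> that starts downwards could reach the parent \<open>u\<close> only through \<open>v\<close> again.\<close>
    have short: "p = [(v, u)]" if path: "G.apath v p u" and parent: "covers le v u" for u v p
    proof (cases p)
      case Nil
      then show ?thesis using path coversD(2)[OF parent] by (auto simp: G.apath_Nil_iff)
    next
      case (Cons e p')
      then obtain y where e: "e = (v, y)" "covers le v y \<or> covers le y v" "G.apath y p' u"
        "v \<notin> set (pawalk_verts y p')"
        using path by (cases e) (auto simp: G.apath_Cons_iff)
      have "\<not> le u v" using parent coversD le_antisym by blast
      then have "\<not> covers le y v"
        using walk_leaves_through[of y p' u v] e coversD by (auto simp: G.apath_def)
      then have "y = u" using e(2) parent covers_unique by blast
      then have "p' = []" using e(3) G.apath_nonempty_ends by blast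
      then show ?thesis using Cons e \<open>y = u\<close> by simp
    qed
    obtain u where u: "G.awalk u c u" "distinct (tl (pawalk_verts u c))" "c \<noteq> []"
      using c by (auto simp: G.cycle_def)
    then obtain v p where p: "c = (u, v) # p" "covers le u v \<or> covers le v u" "G.apath v p u"
      by (cases c) (auto simp: G.awalk_Cons_iff G.apath_def)
    then have "p = [(v, u)] \<or> rev_path p = [(u, v)]"
      using short[of v p u] short[of u "rev_path p" v] by auto
    then have "length p = 1" using rev_path_rev_path[of p] by (auto simp del: rev_path_rev_path)
    then show ?thesis using p(1) by simp
  qed
  ultimately show ?thesis
    unfolding undirected_tree_def using pair_graph_hasse by force
qed

lemma tree_path_up:
  assumes "le x a"
  shows "sorted_wrt (\<lambda>y z. le y z \<and> y \<noteq> z) (tree_path_verts (hasse_graph V le) x a)"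
    and "set (tree_path_verts (hasse_graph V le) x a) = {y. le x y \<and> le y a}"
  using up_path_exists[OF assms] tree_path_eq[OF undirected_tree_hasse]
  by (auto simp: tree_path_verts_def)

lemma tree_path_down:
  assumes "le x a"
  shows "set (tree_path_verts (hasse_graph V le) a x) = {y. le x y \<and> le y a}"
    and "set (tree_path (hasse_graph V le) a x) = {(z, y). covers le y z \<and> le x y \<and> le z a}"
proof -
  interpret G: pair_graph "hasse_graph V le" by (rule pair_graph_hasse)
  obtain p where p: "G.apath x p a" "set (pawalk_verts x p) = {y. le x y \<and> le y a}"
    "set p = {(y, z). covers le y z \<and> le x y \<and> le z a}"
    using up_path_exists[OF assms] by blast
  have rev: "tree_path (hasse_graph V le) a x = rev_path p"
    using p(1) by (intro tree_path_eq[OF undirected_tree_hasse]) simp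
  show "set (tree_path_verts (hasse_graph V le) a x) = {y. le x y \<and> le y a}"
    using p G.awalk_verts_rev_path[of x p a] by (simp add: tree_path_verts_def rev G.apath_def)
  have set_rev: "set (rev_path q) = prod.swap ` set q" for q :: "(nat \<times> nat) list"
    by (induction q) auto
  show "set (tree_path (hasse_graph V le) a x) = {(z, y). covers le y z \<and> le x y \<and> le z a}"
    unfolding rev set_rev p(3) by (auto simp: image_iff)
qed

end

definition order_on :: "'a set \<Rightarrow> ('a \<Rightarrow> 'a \<Rightarrow> bool) \<Rightarrow> 'a \<Rightarrow> 'a \<Rightarrow> bool" where
  "order_on W le x y \<longleftrightarrow> x \<in> W \<and> y \<in> W \<and> le x y"

lemma (in tree_order) tree_order_on:
  assumes "W \<subseteq> V" "q \<in> W" "\<And>x. x \<in> W \<Longrightarrow> le x q"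
  shows "tree_order W q (order_on W le)"
proof
  show "finite W" using finite_V assms(1) by (rule rev_finite_subset)
  show "order_on W le y z \<or> order_on W le z y" if "order_on W le x y" "order_on W le x z" for x y z
    using that le_chain unfolding order_on_def by blast
qed (use assms le_refl le_antisym in \<open>auto simp: order_on_def intro: le_trans\<close>)

section \<open>The ancestor order of a rooted tree\<close>

definition ancestor_order :: "nat pair_pre_digraph \<Rightarrow> nat \<Rightarrow> nat \<Rightarrow> nat \<Rightarrow> bool" where
  "ancestor_order G r x y \<longleftrightarrow> x \<in> pverts G \<and> y \<in> set (tree_path_verts G r x)"

text \<open>
  In terms of the paths from the root the ancestor order is the prefix order on lists, which is a
  partial order in which the prefixes of a given list form a chain.
\<close>

lemma ancestor_order_prefix:
  assumes T: "undirected_tree G" and r: "r \<in> pverts G"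
  shows "ancestor_order G r x y \<longleftrightarrow>
    x \<in> pverts G \<and> y \<in> pverts G \<and> prefix (tree_path G r y) (tree_path G r x)"
proof -
  interpret pair_graph G using T by (rule undirected_treeD)
  show ?thesis
  proof (cases "x \<in> pverts G")
    case True
    have px: "apath r (tree_path G r x) x" using apath_tree_path[OF T r True] .
    show ?thesis
    proof
      assume "ancestor_order G r x y"
      then have "y \<in> set (awalk_verts r (tree_path G r x))"
        by (simp add: ancestor_order_def tree_path_verts_def)
      then obtain q s where qs: "tree_path G r x = q @ s" "awalk r q y" "awalk y s x"
        using awalk_decomp[OF awalkI_apath[OF px]] by blast
      then have "apath r q y"
        using px awlast_of_awalk[of r q y] by (auto simp: apath_append_iff)
      then have "tree_path G r y = q" by (rule tree_path_eq[OF T])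
      then show "x \<in> pverts G \<and> y \<in> pverts G \<and> prefix (tree_path G r y) (tree_path G r x)"
        using qs True awalk_last_in_verts[of r q y] by auto
    next
      assume y: "x \<in> pverts G \<and> y \<in> pverts G \<and> prefix (tree_path G r y) (tree_path G r x)"
      then obtain s where s: "tree_path G r x = tree_path G r y @ s" by (auto simp: prefix_def)
      have py: "apath r (tree_path G r y) y" using apath_tree_path[OF T r] y by blast
      have "awalk r (tree_path G r y @ s) x" using px s by (simp add: apath_def)
      then have "awalk y s x"
        using awlast_of_awalk[of r "tree_path G r y" y] py by (auto simp: apath_def)
      then have "y \<in> set (awalk_verts r (tree_path G r y @ s))"
        using set_awalk_verts_append[OF awalkI_apath[OF py]] hd_in_awalk_verts(1) by blast
      then show "ancestor_order G r x y"
        using True s by (simp add: ancestor_order_def tree_path_verts_def)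
    qed
  qed (simp add: ancestor_order_def)
qed

lemma tree_order_ancestor_order:
  assumes T: "undirected_tree G" and r: "r \<in> pverts G"
  shows "tree_order (pverts G) r (ancestor_order G r)"
proof -
  interpret pair_graph G using T by (rule undirected_treeD)
  note le = ancestor_order_prefix[OF T r]
  have "x = y" if "x \<in> pverts G" "y \<in> pverts G" "tree_path G r x = tree_path G r y" for x y
    using apath_tree_path[OF T r that(1)] apath_tree_path[OF T r that(2)] that(3)
      apath_ends[of r "tree_path G r x" x r y] by auto
  moreover have "tree_path G r r = []"
    using r by (intro tree_path_eq[OF T]) (simp add: apath_Nil_iff)
  ultimately show ?thesis
    using r pair_finite_verts
    by unfold_locales (auto simp: le dest: prefix_order.antisym prefix_order.trans prefix_same_cases)
qed

lemma tree_path_snoc: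
  assumes T: "undirected_tree G" and r: "r \<in> pverts G" and x: "x \<in> pverts G" and "x \<noteq> r"
  obtains w where "(w, x) \<in> parcs G" "tree_path G r x = tree_path G r w @ [(w, x)]"
proof -
  interpret pair_graph G using T by (rule undirected_treeD)
  have px: "apath r (tree_path G r x) x" using apath_tree_path[OF T r x] .
  then have "tree_path G r x \<noteq> []" using \<open>x \<noteq> r\<close> by (auto simp: apath_Nil_iff)
  then obtain p e where p: "tree_path G r x = p @ [e]" by (metis rev_exhaust)
  obtain w z where "e = (w, z)" by (cases e)
  then have "apath r p w" "e = (w, x)" "(w, x) \<in> parcs G"
    using px unfolding p by (auto simp: apath_append_iff apath_simps)
  then show thesis using that[of w] p tree_path_eq[OF T] by simp
qed

text \<open>
  Of two adjacent vertices one has a path from the root that extends the path of the other by the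
  arc between them, because paths are unique. These extensions are exactly the covering pairs.
\<close>

lemma hasse_graph_ancestor_order:
  assumes T: "undirected_tree G" and r: "r \<in> pverts G"
  shows "hasse_graph (pverts G) (ancestor_order G r) = G"
proof -
  interpret pair_graph G using T by (rule undirected_treeD)
  interpret O: tree_order "pverts G" r "ancestor_order G r" by (rule tree_order_ancestor_order[OF T r])
  note le = ancestor_order_prefix[OF T r]
  have snoc_covers: "covers (ancestor_order G r) x w"
    if "x \<in> pverts G" "w \<in> pverts G" "tree_path G r x = tree_path G r w @ [(w, x)]" for x w
    unfolding covers_def
  proof (intro conjI allI impI)
    show "ancestor_order G r x w" "x \<noteq> w" using that by (auto simp: le)
    fix z assume "ancestor_order G r x z" "ancestor_order G r z w"
    then have z: "z \<in> pverts G" "prefix (tree_path G r z) (tree_path G r w @ [(w, x)])"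
      "prefix (tree_path G r w) (tree_path G r z)" using that(3) by (simp_all add: le)
    then have "tree_path G r z = tree_path G r x \<or> tree_path G r z = tree_path G r w"
      unfolding prefix_snoc that(3) using prefix_order.antisym by blast
    then have "ancestor_order G r z x \<and> ancestor_order G r x z \<or> ancestor_order G r z w \<and> ancestor_order G r w z"
      using that(1,2) z(1) by (auto simp: le)
    then show "z = x \<or> z = w" using O.le_antisym by blast
  qed
  have arc_covers: "(x, y) \<in> parcs G \<longleftrightarrow> covers (ancestor_order G r) x y \<or> covers (ancestor_order G r) y x" for x y
  proof
    have up: "(x, y) \<in> parcs G" if c: "covers (ancestor_order G r) x y" for x y
    proof -
      have "ancestor_order G r x y" "x \<noteq> y" using O.coversD[OF c] .
      then have x: "x \<in> pverts G" "x \<noteq> r" using O.le_in O.le_antisym O.le_root by blast+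
      then obtain w where w: "(w, x) \<in> parcs G" "tree_path G r x = tree_path G r w @ [(w, x)]"
        using tree_path_snoc[OF T r] by blast
      then have "covers (ancestor_order G r) x w" using snoc_covers in_arcsD1 in_arcsD2 by blast
      then show ?thesis using O.covers_unique[OF c] w arcs_symmetric by blast
    qed
    show "(x, y) \<in> parcs G" if "covers (ancestor_order G r) x y \<or> covers (ancestor_order G r) y x"
      using that up arcs_symmetric by blast
    assume xy: "(x, y) \<in> parcs G"
    then have V: "x \<in> pverts G" "y \<in> pverts G" and "x \<noteq> y" using in_arcsD1 in_arcsD2 no_loops' by blast+
    have px: "apath r (tree_path G r x) x" and py: "apath r (tree_path G r y) y"
      using apath_tree_path[OF T r] V by blast+
    show "covers (ancestor_order G r) x y \<or> covers (ancestor_order G r) y x"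
    proof (cases "ancestor_order G r x y")
      case True
      then obtain s where s: "tree_path G r x = tree_path G r y @ s" by (auto simp: le prefix_def)
      have "apath y s x" using px awlast_of_awalk[OF awalkI_apath[OF py]]
        unfolding s by (auto simp: apath_append_iff)
      moreover have "apath y [(y, x)] x" using arcs_symmetric[OF xy] V \<open>x \<noteq> y\<close> by (auto simp: apath_simps)
      ultimately have "s = [(y, x)]" using tree_apath_unique[OF T] by blast
      then show ?thesis using snoc_covers V s by blast
    next
      case False
      then have "y \<notin> set (awalk_verts r (tree_path G r x))"
        using V by (simp add: ancestor_order_def tree_path_verts_def)
      then have "apath r (tree_path G r x @ [(x, y)]) y"
        using px xy V \<open>x \<noteq> y\<close> awlast_of_awalk[OF awalkI_apath[OF px]]
        by (auto simp: apath_append_iff apath_simps)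
      then have "tree_path G r y = tree_path G r x @ [(x, y)]" by (rule tree_path_eq[OF T])
      then show ?thesis using snoc_covers V by blast
    qed
  qed
  show ?thesis
    by (rule pair_pre_digraph.equality) (auto simp: hasse_graph_def arc_covers)
qed

lemma (in tree_order) ancestor_order_hasse: "ancestor_order (hasse_graph V le) r = le"
proof (intro ext)
  fix x y
  show "ancestor_order (hasse_graph V le) r x y = le x y"
    using tree_path_down(1)[OF le_root, of x] le_root le_in by (auto simp: ancestor_order_def)
qed

section \<open>Binary tree orders and their clusters\<close>

lemma out_degree_conv_card: "out_degree (with_proj G) v = card {w. (v, w) \<in> parcs G}"
proof -
  have "out_arcs (with_proj G) v = Pair v ` {w. (v, w) \<in> parcs G}"
    by (auto simp: out_arcs_def)
  then show ?thesis unfolding out_degree_def by (simp add: card_image inj_on_def)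
qed

context tree_order
begin

lemma finite_children: "finite {c. covers le c v}"
  by (rule finite_subset[OF _ finite_down[of v]]) (use coversD in blast)

lemma children_empty_iff: "{c. covers le c v} = {} \<longleftrightarrow> (\<forall>x. le x v \<longrightarrow> x = v)"
  using child_exists coversD by blast

lemma out_degree_hasse:
  assumes "v \<in> V"
  shows "out_degree (with_proj (hasse_graph V le)) v =
    card {c. covers le c v} + (if v = r then 0 else 1)"
proof -
  have nbrs: "{w. (v, w) \<in> parcs (hasse_graph V le)} = {c. covers le c v} \<union> {p. covers le v p}"
    by auto
  show ?thesis
  proof (cases "v = r")
    case True
    then have "\<not> covers le v p" for p
      using coversD le_root le_antisym le_in by blast
    then have "{w. (v, w) \<in> parcs (hasse_graph V le)} = {c. covers le c v}" by auto
    then show ?thesis using True unfolding out_degree_conv_card by simp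
  next
    case False
    obtain p where p: "covers le v p" using parent_exists[OF le_root[OF assms] False] by blast
    then have "{p. covers le v p} = {p}" using covers_unique by blast
    moreover have "p \<notin> {c. covers le c v}" using p coversD le_antisym by blast
    ultimately show ?thesis
      using False finite_children unfolding out_degree_conv_card nbrs by simp
  qed
qed

lemma siblings_disjoint:
  assumes "covers le c v" "covers le d v" "c \<noteq> d" "le z c" "le z d"
  shows False
  using assms le_chain[of z c d] unfolding covers_def by blast

end

definition leaf_cluster :: "('a \<Rightarrow> 'a \<Rightarrow> bool) \<Rightarrow> 'a set \<Rightarrow> 'a \<Rightarrow> 'a set" where
  "leaf_cluster le L v = {x \<in> L. le x v}"

locale binary_tree_order = tree_order +
  fixes L :: "nat set"
  assumes minimal_iff_leaf: "{v \<in> V. \<forall>x. le x v \<longrightarrow> x = v} = L"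
    and card_children: "v \<in> V \<Longrightarrow> v \<notin> L \<Longrightarrow> card {c. covers le c v} = 2"
begin

lemma leaf_in: "x \<in> L \<Longrightarrow> x \<in> V" and below_leaf: "x \<in> L \<Longrightarrow> le u x \<Longrightarrow> u = x"
  using minimal_iff_leaf by blast+

lemma leaf_below: "v \<in> V \<Longrightarrow> \<exists>x\<in>L. le x v"
proof (induction "card {z. le z v}" arbitrary: v rule: less_induct)
  case less
  show ?case
  proof (cases "v \<in> L")
    case False
    then obtain u where u: "le u v" "u \<noteq> v" using less.prems minimal_iff_leaf by blast
    then obtain x where "x \<in> L" "le x u"
      using less.hyps[OF card_down_less] le_in by blast
    then show ?thesis using u le_trans by blast
  qed (use less.prems le_refl in blast)
qed

lemma two_children:
  assumes "v \<in> V" "v \<notin> L"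
  obtains c d where "c \<noteq> d" "{c. covers le c v} = {c, d}"
  using card_children[OF assms] by (meson card_2_iff)

lemma cluster_subset_iff:
  assumes "u \<in> V" "v \<in> V"
  shows "leaf_cluster le L u \<subseteq> leaf_cluster le L v \<longleftrightarrow> le u v"
proof
  assume sub: "leaf_cluster le L u \<subseteq> leaf_cluster le L v"
  obtain x where x: "x \<in> L" "le x u" using leaf_below assms by blast
  then have "le x v" using sub by (auto simp: leaf_cluster_def)
  show "le u v"
  proof (rule ccontr)
    assume not: "\<not> le u v"
    then have vu: "le v u" "v \<noteq> u" using le_chain[OF x(2) \<open>le x v\<close>] le_refl assms by blast+
    then have "u \<notin> L" using below_leaf by blast
    obtain c where c: "covers le c u" "le v c" using child_exists[OF vu] by blast
    \<comment> \<open>The sibling \<open>d\<close> of \<open>c\<close> has leaves that lie below \<open>u\<close> but not below \<open>v\<close>.\<close>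
    obtain d where d: "covers le d u" "d \<noteq> c"
      using two_children[OF assms(1) \<open>u \<notin> L\<close>] by (metis insertCI mem_Collect_eq)
    obtain y where y: "y \<in> L" "le y d" using leaf_below[of d] coversD[OF d(1)] le_in by blast
    then have "le y u" using coversD(1)[OF d(1)] le_trans by blast
    then have "le y v" using sub y(1) by (auto simp: leaf_cluster_def)
    then show False using siblings_disjoint[OF d(1) c(1) d(2) y(2)] c(2) le_trans by blast
  qed
qed (auto simp: leaf_cluster_def intro: le_trans)

lemma inj_on_cluster: "inj_on (leaf_cluster le L) V"
  by (rule inj_onI) (metis cluster_subset_iff le_antisym subset_refl)

lemma cluster_leaf: "x \<in> L \<Longrightarrow> leaf_cluster le L x = {x}"
  using below_leaf leaf_in le_refl by (auto simp: leaf_cluster_def)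

lemma cluster_root: "leaf_cluster le L r = L"
  using leaf_in le_root by (auto simp: leaf_cluster_def)

lemma binary_hierarchy_clusters: "binary_hierarchy L (leaf_cluster le L ` V)"
  unfolding binary_hierarchy_def
proof (intro conjI)
  show "leaf_cluster le L ` V \<subseteq> Pow L" by (auto simp: leaf_cluster_def)
  show "{} \<notin> leaf_cluster le L ` V" using leaf_below by (fastforce simp: leaf_cluster_def)
  show "L \<in> leaf_cluster le L ` V" using cluster_root root_in by (metis image_eqI)
  show "\<forall>x\<in>L. {x} \<in> leaf_cluster le L ` V" using cluster_leaf leaf_in by (metis image_eqI)
  have "leaf_cluster le L u \<subseteq> leaf_cluster le L v \<or> leaf_cluster le L v \<subseteq> leaf_cluster le L u \<or>
      leaf_cluster le L u \<inter> leaf_cluster le L v = {}" if "u \<in> V" "v \<in> V" for u v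
    using cluster_subset_iff[OF that] cluster_subset_iff[OF that(2,1)] le_chain[of _ u v]
    by (auto simp: leaf_cluster_def)
  then show "\<forall>C\<in>leaf_cluster le L ` V. \<forall>D\<in>leaf_cluster le L ` V. C \<subseteq> D \<or> D \<subseteq> C \<or> C \<inter> D = {}"
    by simp
  have "(\<exists>x. leaf_cluster le L v = {x}) \<or>
      (\<exists>c\<in>V. \<exists>d\<in>V. leaf_cluster le L c \<inter> leaf_cluster le L d = {} \<and>
        leaf_cluster le L v = leaf_cluster le L c \<union> leaf_cluster le L d)" if v: "v \<in> V" for v
  proof (cases "v \<in> L")
    case False
    obtain c d where cd: "c \<noteq> d" "{c. covers le c v} = {c, d}"
      using two_children[OF v False] .
    then have cov: "covers le c v" "covers le d v" by blast+
    have children: "e = c \<or> e = d" if "covers le e v" for e using cd(2) that by (simp add: set_eq_iff)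
    have "leaf_cluster le L c \<inter> leaf_cluster le L d = {}"
      using siblings_disjoint[OF cov cd(1)] by (auto simp: leaf_cluster_def)
    moreover have "leaf_cluster le L v = leaf_cluster le L c \<union> leaf_cluster le L d"
    proof -
      have "le x c \<or> le x d" if x: "x \<in> L" "le x v" for x
      proof -
        have "x \<noteq> v" using x False by blast
        then obtain e where "covers le e v" "le x e" using child_exists x by blast
        then show ?thesis using children by blast
      qed
      moreover have "le x v" if "le x c \<or> le x d" for x
        using that coversD(1)[OF cov(1)] coversD(1)[OF cov(2)] le_trans by blast
      ultimately show ?thesis unfolding leaf_cluster_def by blast
    qed
    moreover have "c \<in> V" "d \<in> V" using cov coversD(1) le_in by blast+
    ultimately show ?thesis by blast
  qed (use cluster_leaf in blast)
  then show "\<forall>C\<in>leaf_cluster le L ` V. (\<exists>x. C = {x}) \<or>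
      (\<exists>D\<in>leaf_cluster le L ` V. \<exists>E\<in>leaf_cluster le L ` V. D \<inter> E = {} \<and> C = D \<union> E)"
    by simp
qed

end

text \<open>
  An order isomorphism onto a hierarchy gives the two children of a vertex as the two halves of its
  cluster. This helps where the children are hard to see directly, namely in the tree built from a
  given hierarchy and in the tree induced by a set of leaves.
\<close>

lemma (in tree_order) binary_tree_orderI:
  assumes h: "binary_hierarchy L H"
    and g: "bij_betw g V H"
    and le_iff: "\<And>x y. x \<in> V \<Longrightarrow> y \<in> V \<Longrightarrow> le x y \<longleftrightarrow> g x \<subseteq> g y"
    and leaf: "\<And>x. x \<in> L \<Longrightarrow> x \<in> V \<and> g x = {x}"
  shows "binary_tree_order V r le L" "leaf_cluster le L ` V = H"
proof -
  have gH: "g v \<in> H" if "v \<in> V" for v using g that by (auto simp: bij_betw_def)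
  have g_inj: "u = v" if "u \<in> V" "v \<in> V" "g u = g v" for u v
    using g that by (auto simp: bij_betw_def dest: inj_onD)
  have g_surj: "\<exists>v\<in>V. C = g v" if "C \<in> H" for C using g that by (auto simp: bij_betw_def)
  have singleton: "v \<in> L" if "v \<in> V" "g v = {x}" for v x
  proof -
    have "x \<in> L" using binary_hierarchyD(1)[OF h gH[OF that(1)]] that(2) by simp
    then show ?thesis using leaf[of x] g_inj[of v x] that by auto
  qed
  show "leaf_cluster le L ` V = H"
  proof -
    have "leaf_cluster le L v = g v" if "v \<in> V" for v
      using leaf le_iff[OF _ that] binary_hierarchyD(1)[OF h gH[OF that]]
      by (auto simp: leaf_cluster_def)
    then have "leaf_cluster le L ` V = g ` V" by (rule image_cong[OF refl])
    then show ?thesis using g by (simp add: bij_betw_def)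
  qed
  show "binary_tree_order V r le L"
  proof
    show "{v \<in> V. \<forall>x. le x v \<longrightarrow> x = v} = L"
    proof (intro set_eqI iffI)
      fix v assume v: "v \<in> {v \<in> V. \<forall>x. le x v \<longrightarrow> x = v}"
      then obtain x where x: "x \<in> g v" using binary_hierarchyD(2)[OF h gH] by blast
      then have "x \<in> L" using binary_hierarchyD(1)[OF h gH] v by blast
      then have "le x v" using leaf[of x] le_iff[of x v] x v by auto
      then show "v \<in> L" using v \<open>x \<in> L\<close> by blast
    next
      fix x assume x: "x \<in> L"
      have "u = x" if u: "le u x" for u
      proof -
        have "g u \<subseteq> {x}" using le_iff[of u x] leaf[OF x] u le_in by auto
        then have "g u = g x" using binary_hierarchyD(2)[OF h gH, of u] leaf[OF x] u le_in by auto
        then show ?thesis using g_inj u le_in by blast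
      qed
      then show "x \<in> {v \<in> V. \<forall>x. le x v \<longrightarrow> x = v}" using leaf[OF x] by blast
    qed
  next
    fix v assume v: "v \<in> V" "v \<notin> L"
    then have "\<nexists>x. g v = {x}" using singleton by blast
    then obtain D E where DE: "D \<in> H" "E \<in> H" "D \<inter> E = {}" "g v = D \<union> E"
      using binary_hierarchy_split[OF h gH[OF v(1)]] by blast
    obtain c d where cd: "c \<in> V" "D = g c" "d \<in> V" "E = g d" using g_surj DE by metis
    have ne: "D \<noteq> {}" "E \<noteq> {}" using binary_hierarchyD(2)[OF h] DE by auto
    \<comment> \<open>Every cluster strictly inside \<open>D \<union> E\<close> lies in one of the halves.\<close>
    have below: "le u c \<or> le u d" if u: "le u v" "u \<noteq> v" for u
    proof -
      have uV: "u \<in> V" using u le_in by blast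
      have "g u \<subseteq> D \<union> E" "g u \<noteq> D \<union> E" using le_iff[OF uV v(1)] u DE g_inj[OF uV v(1)] by auto
      then have "g u \<subseteq> D \<or> g u \<subseteq> E"
        using binary_hierarchyD(5)[OF h gH[OF uV] DE(1)] binary_hierarchyD(5)[OF h gH[OF uV] DE(2)] DE(3)
        by blast
      then show ?thesis using le_iff[OF uV] cd by blast
    qed
    have cv: "le c v" "c \<noteq> v" "le d v" "d \<noteq> v" "\<not> le c d" "\<not> le d c"
      using le_iff cd v DE ne by auto
    have child: "covers le c v" "covers le d v"
      unfolding covers_def using cv below le_antisym le_trans by metis+
    have "{e. covers le e v} = {c, d}"
    proof (intro set_eqI iffI)
      fix e assume "e \<in> {e. covers le e v}"
      then have e: "covers le e v" by simp
      then have "le e c \<or> le e d" using below coversD by blast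
      then show "e \<in> {c, d}" using e cv unfolding covers_def by blast
    qed (use child in blast)
    moreover have "c \<noteq> d" using cv le_refl cd by blast
    ultimately show "card {e. covers le e v} = 2" by simp
  qed
qed

section \<open>Isomorphisms\<close>

lemma hasse_graph_iso:
  assumes "tree_order V r le" "tree_order V' r' le'" and h: "bij_betw h V V'"
    and le: "\<And>x y. x \<in> V \<Longrightarrow> y \<in> V \<Longrightarrow> le' (h x) (h y) \<longleftrightarrow> le x y"
    and fixed: "\<And>x. x \<in> L \<Longrightarrow> h x = x"
  shows "\<exists>i. iso_fixing L (hasse_graph V le) (hasse_graph V' le') i \<and> iso_verts i = h"
proof -
  interpret A: tree_order V r le by fact
  interpret B: tree_order V' r' le' by fact
  interpret G: pair_graph "hasse_graph V le" by (rule A.pair_graph_hasse)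
  have inj: "inj_on h V" and img: "V' = h ` V" using h by (auto simp: bij_betw_def)
  have covers: "covers le' (h x) (h y) \<longleftrightarrow> covers le x y" if "x \<in> V" "y \<in> V" for x y
  proof -
    have "covers le' (h x) (h y) \<longleftrightarrow> le' (h x) (h y) \<and> h x \<noteq> h y \<and>
        (\<forall>z\<in>h ` V. le' (h x) z \<longrightarrow> le' z (h y) \<longrightarrow> z = h x \<or> z = h y)"
      using B.le_in img unfolding covers_def by blast
    also have "\<dots> \<longleftrightarrow> le x y \<and> x \<noteq> y \<and> (\<forall>z\<in>V. le x z \<longrightarrow> le z y \<longrightarrow> z = x \<or> z = y)"
      using that by (simp add: le inj_on_eq_iff[OF inj] cong: ball_cong)
    also have "\<dots> \<longleftrightarrow> covers le x y" using A.le_in unfolding covers_def by blast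
    finally show ?thesis .
  qed
  define i where "i = \<lparr> iso_verts = h, iso_arcs = map_prod h h, iso_head = snd, iso_tail = (fst :: nat \<times> nat \<Rightarrow> nat) \<rparr>"
  have "inj_on (map_prod h h) (parcs (hasse_graph V le))"
    by (rule inj_on_subset[OF map_prod_inj_on[OF inj inj]]) (use G.in_arcsD1 G.in_arcsD2 in auto)
  then have "G.digraph_isomorphism i"
    using inj G.wf_digraph_axioms unfolding G.digraph_isomorphism_def by (auto simp: i_def)
  moreover have "parcs (hasse_graph V' le') = map_prod h h ` parcs (hasse_graph V le)"
  proof (intro set_eqI iffI)
    fix e assume e: "e \<in> parcs (hasse_graph V' le')"
    obtain x' y' where xy': "e = (x', y')" by (cases e)
    then have "x' \<in> V'" "y' \<in> V'" using e B.coversD(1) B.le_in by auto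
    then obtain x y where xy: "x \<in> V" "y \<in> V" "x' = h x" "y' = h y" using img by blast
    then have "(x, y) \<in> parcs (hasse_graph V le)" using e covers xy' by simp
    then show "e \<in> map_prod h h ` parcs (hasse_graph V le)" using xy xy' by force
  next
    fix e assume "e \<in> map_prod h h ` parcs (hasse_graph V le)"
    then obtain x y where xy: "(x, y) \<in> parcs (hasse_graph V le)" "e = (h x, h y)" by auto
    then have "x \<in> V" "y \<in> V" using A.coversD(1) A.le_in by auto
    then show "e \<in> parcs (hasse_graph V' le')" using xy covers by simp
  qed
  then have "with_proj (hasse_graph V' le') = app_iso i (with_proj (hasse_graph V le))"
    by (intro pre_digraph.equality) (auto simp: i_def img)
  ultimately show ?thesis using fixed unfolding iso_fixing_def by (intro exI[of _ i]) (auto simp: i_def)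
qed

text \<open>
  An isomorphism maps the path from the root \<open>r\<close> to \<open>x\<close> to a path between their images, which is
  the only one because the image is a tree, too.
\<close>

lemma iso_fixing_ancestor_order:
  assumes T: "undirected_tree G" "undirected_tree H" and i: "iso_fixing L G H i" and r: "r \<in> pverts G"
  shows "pverts H = iso_verts i ` pverts G" "inj_on (iso_verts i) (pverts G)"
    "x \<in> pverts G \<Longrightarrow> y \<in> pverts G \<Longrightarrow>
      ancestor_order H (iso_verts i r) (iso_verts i x) (iso_verts i y) \<longleftrightarrow> ancestor_order G r x y"
proof -
  interpret G: pair_graph G using T(1) by (rule undirected_treeD)
  have iso: "G.digraph_isomorphism i" and app: "with_proj H = app_iso i (with_proj G)"
    using i by (auto simp: iso_fixing_def)
  have "verts (with_proj H) = verts (app_iso i (with_proj G))" using app by simp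
  then show V: "pverts H = iso_verts i ` pverts G" by simp
  show inj: "inj_on (iso_verts i) (pverts G)" using iso G.digraph_isomorphism_inj_on_verts by auto
  assume xy: "x \<in> pverts G" "y \<in> pverts G"
  let ?p = "tree_path G r x"
  have p: "G.awalk r ?p x" "distinct (pawalk_verts r ?p)"
    using apath_tree_path[OF T(1) r xy(1)] by (auto simp: G.apath_def)
  have sub: "set (pawalk_verts r ?p) \<subseteq> pverts G" using p(1) by auto
  have verts: "pawalk_verts (iso_verts i r) (map (iso_arcs i) ?p) = map (iso_verts i) (pawalk_verts r ?p)"
    using G.awalk_verts_app_iso_eq[OF iso p(1)] unfolding app[symmetric] awalk_verts_with_proj_eq .
  have "pre_digraph.awalk (with_proj H) (iso_verts i r) (map (iso_arcs i) ?p) (iso_verts i x)"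
    using G.awalk_app_isoI[OF p(1) iso] unfolding app .
  moreover have "distinct (pawalk_verts (iso_verts i r) (map (iso_arcs i) ?p))"
    unfolding verts using p(2) inj_on_subset[OF inj sub] by (simp add: distinct_map)
  ultimately have "tree_path H (iso_verts i r) (iso_verts i x) = map (iso_arcs i) ?p"
    by (intro tree_path_eq[OF T(2)]) (simp add: pre_digraph.apath_def awalk_verts_with_proj_eq)
  then have "set (tree_path_verts H (iso_verts i r) (iso_verts i x)) = iso_verts i ` set (pawalk_verts r ?p)"
    by (simp add: tree_path_verts_def verts)
  then show "ancestor_order H (iso_verts i r) (iso_verts i x) (iso_verts i y) \<longleftrightarrow> ancestor_order G r x y"
    using xy V inj_on_image_mem_iff[OF inj xy(2) sub] by (simp add: ancestor_order_def tree_path_verts_def)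
qed

text \<open>
  Sending each vertex to the vertex with the same cluster is an order isomorphism because the order
  is inclusion of clusters.
\<close>

lemma binary_tree_order_iso:
  assumes "binary_tree_order V r le L" "binary_tree_order V' r' le' L"
    and eq: "leaf_cluster le L ` V = leaf_cluster le' L ` V'"
  shows "\<exists>h. bij_betw h V V' \<and> h r = r' \<and> (\<forall>x\<in>L. h x = x) \<and>
    (\<forall>x\<in>V. \<forall>y\<in>V. le' (h x) (h y) \<longleftrightarrow> le x y)"
proof -
  interpret A: binary_tree_order V r le L by fact
  interpret B: binary_tree_order V' r' le' L by fact
  define h where "h = the_inv_into V' (leaf_cluster le' L) \<circ> leaf_cluster le L"
  have "bij_betw (leaf_cluster le L) V (leaf_cluster le L ` V)"
    "bij_betw (leaf_cluster le' L) V' (leaf_cluster le L ` V)"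
    using A.inj_on_cluster B.inj_on_cluster eq by (simp_all add: bij_betw_def)
  then have bij: "bij_betw h V V'"
    unfolding h_def by (intro bij_betw_trans[OF _ bij_betw_the_inv_into])
  have cl: "leaf_cluster le' L (h x) = leaf_cluster le L x" if "x \<in> V" for x
    unfolding h_def comp_def
    by (rule f_the_inv_into_f[OF B.inj_on_cluster]) (use eq that in blast)
  have hV: "h x \<in> V'" if "x \<in> V" for x using bij that by (auto simp: bij_betw_def)
  have uniq: "h x = y" if "x \<in> V" "y \<in> V'" "leaf_cluster le L x = leaf_cluster le' L y" for x y
    using that cl B.inj_on_cluster hV by (metis inj_onD)
  have "h r = r'"
    using uniq[OF A.root_in B.root_in] A.cluster_root B.cluster_root by simp
  moreover have "h x = x" if "x \<in> L" for x
    using uniq[OF A.leaf_in B.leaf_in] A.cluster_leaf B.cluster_leaf that by simp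
  moreover have "le' (h x) (h y) \<longleftrightarrow> le x y" if "x \<in> V" "y \<in> V" for x y
    using that A.cluster_subset_iff B.cluster_subset_iff hV cl by metis
  ultimately show ?thesis using bij by blast
qed

lemma leaf_cluster_image_iso:
  assumes V: "V' = h ` V" and L: "L \<subseteq> V" "\<And>x. x \<in> L \<Longrightarrow> h x = x"
    and le: "\<And>x y. x \<in> V \<Longrightarrow> y \<in> V \<Longrightarrow> le' (h x) (h y) \<longleftrightarrow> le x y"
  shows "leaf_cluster le' L ` V' = leaf_cluster le L ` V"
proof -
  have "leaf_cluster le' L (h v) = leaf_cluster le L v" if "v \<in> V" for v
    using L le[OF _ that] by (auto simp: leaf_cluster_def subset_iff) metis+
  then show ?thesis unfolding V image_image by (rule image_cong[OF refl])
qed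

section \<open>Rooted binary trees as hierarchies\<close>

definition rooted_clusters :: "nat set \<Rightarrow> rooted_graph \<Rightarrow> nat set set" where
  "rooted_clusters S = (\<lambda>(G, r). leaf_cluster (ancestor_order G r) S ` pverts G)"

lemma children_eq_covers:
  assumes T: "undirected_tree G" and r: "r \<in> pverts G"
  shows "children G r v = {c. covers (ancestor_order G r) c v}"
proof -
  interpret tree_order "pverts G" r "ancestor_order G r" by (rule tree_order_ancestor_order[OF T r])
  have arcs: "(v, w) \<in> parcs G \<longleftrightarrow> covers (ancestor_order G r) v w \<or> covers (ancestor_order G r) w v" for w
    using hasse_graph_simps(2)[of v w "pverts G" "ancestor_order G r"]
    unfolding hasse_graph_ancestor_order[OF T r] .
  have "w \<in> children G r v \<longleftrightarrow> (v, w) \<in> parcs G \<and> ancestor_order G r w v" for w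
    using arcs coversD(1) le_in unfolding children_def ancestor_order_def by blast
  then show ?thesis using arcs coversD le_antisym by blast
qed

lemma rooted_binary_trees_iff:
  "(G, r) \<in> rooted_binary_trees S \<longleftrightarrow>
     undirected_tree G \<and> r \<in> pverts G \<and> binary_tree_order (pverts G) r (ancestor_order G r) S"
proof (cases "undirected_tree G \<and> r \<in> pverts G")
  case True
  then have T: "undirected_tree G" and r: "r \<in> pverts G" by auto
  interpret tree_order "pverts G" r "ancestor_order G r" by (rule tree_order_ancestor_order[OF T r])
  show ?thesis
    unfolding rooted_binary_trees_def binary_tree_order_def binary_tree_order_axioms_def
      mem_Collect_eq case_prod_conv children_eq_covers[OF T r] children_empty_iff
    using True tree_order_axioms by blast
qed (auto simp: rooted_binary_trees_def)

lemma rooted_iso_iff: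
  "(X, Y) \<in> rooted_iso S \<longleftrightarrow> X \<in> rooted_binary_trees S \<and> Y \<in> rooted_binary_trees S \<and>
     rooted_clusters S X = rooted_clusters S Y"
proof -
  obtain G r H q where XY: "X = (G, r)" "Y = (H, q)" by (metis surj_pair)
  show ?thesis
  proof (cases "X \<in> rooted_binary_trees S \<and> Y \<in> rooted_binary_trees S")
    case True
    then have T: "undirected_tree G" "undirected_tree H" and V: "r \<in> pverts G" "q \<in> pverts H"
      and B: "binary_tree_order (pverts G) r (ancestor_order G r) S"
        "binary_tree_order (pverts H) q (ancestor_order H q) S"
      by (auto simp: XY rooted_binary_trees_iff)
    have "rooted_clusters S X = rooted_clusters S Y" if "iso_fixing S G H i" "iso_verts i r = q" for i
    proof -
      note iso = iso_fixing_ancestor_order[OF T that(1) V(1)]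
      have "leaf_cluster (ancestor_order H q) S ` pverts H = leaf_cluster (ancestor_order G r) S ` pverts G"
        using that iso(1,3) binary_tree_order.leaf_in[OF B(1)]
        by (intro leaf_cluster_image_iso[of _ "iso_verts i"]) (auto simp: iso_fixing_def)
      then show ?thesis by (simp add: XY rooted_clusters_def)
    qed
    moreover have "\<exists>i. iso_fixing S G H i \<and> iso_verts i r = q" if eq: "rooted_clusters S X = rooted_clusters S Y"
    proof -
      obtain h where h: "bij_betw h (pverts G) (pverts H)" "h r = q" "\<forall>x\<in>S. h x = x"
        "\<forall>x\<in>pverts G. \<forall>y\<in>pverts G. ancestor_order H q (h x) (h y) \<longleftrightarrow> ancestor_order G r x y"
        using binary_tree_order_iso[OF B] eq by (auto simp: XY rooted_clusters_def)
      then have "\<exists>i. iso_fixing S (hasse_graph (pverts G) (ancestor_order G r))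
          (hasse_graph (pverts H) (ancestor_order H q)) i \<and> iso_verts i = h"
        by (intro hasse_graph_iso[OF tree_order_ancestor_order tree_order_ancestor_order] T V) auto
      then show ?thesis using h(2) hasse_graph_ancestor_order T V by metis
    qed
    ultimately show ?thesis using True by (auto simp: XY rooted_iso_def)
  qed (auto simp: XY rooted_iso_def)
qed

section \<open>Unrooted binary trees as hierarchies\<close>

text \<open>
  An unrooted tree that hangs from a leaf has a root with a single child. The rest of it is the
  binary tree of interest.
\<close>

lemma (in tree_order) delete_root:
  assumes "{c. covers le c r} = {v0}"
  shows "tree_order (V - {r}) v0 (order_on (V - {r}) le)"
    and "y \<noteq> r \<Longrightarrow> covers (order_on (V - {r}) le) x y \<longleftrightarrow> covers le x y"
proof -
  have v0: "v0 \<in> V - {r}" using assms coversD[of v0 r] le_in by blast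
  have "c = v0" if "covers le c r" for c using assms that by (simp add: set_eq_iff)
  then have "le x v0" if "x \<in> V - {r}" for x
    using child_exists[of x r] le_root[of x] that by blast
  then show "tree_order (V - {r}) v0 (order_on (V - {r}) le)"
    using v0 by (intro tree_order_on) auto
  have "x \<noteq> r" if "le x y" "y \<noteq> r" for x y
    using that le_root[of y] le_antisym le_in by blast
  then show "covers (order_on (V - {r}) le) x y \<longleftrightarrow> covers le x y" if "y \<noteq> r"
    using that le_in unfolding covers_def order_on_def by (metis DiffI singletonD)
qed

text \<open>
  Away from the root one neighbour is the parent, so degree 3 means two children and degree 1 means
  none. The root \<open>l\<close>, being a leaf of the unrooted tree, has one child \<open>v0\<close>.
\<close>

lemma unrooted_binary_tree_order:
  assumes G: "G \<in> unrooted_binary_trees n" and l: "l \<in> {1..n}"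
  obtains v0 where "{c. covers (ancestor_order G l) c l} = {v0}"
    "binary_tree_order (pverts G - {l}) v0 (order_on (pverts G - {l}) (ancestor_order G l)) ({1..n} - {l})"
proof -
  have T: "undirected_tree G" and leaves: "{v \<in> pverts G. out_degree (with_proj G) v = 1} = {1..n}"
    and inner: "\<forall>v \<in> pverts G - {1..n}. out_degree (with_proj G) v = 3"
    using G by (auto simp: unrooted_binary_trees_def)
  have lV: "l \<in> pverts G" using l leaves by blast
  let ?le = "ancestor_order G l" and ?W = "pverts G - {l}"
  interpret tree_order "pverts G" l ?le by (rule tree_order_ancestor_order[OF T lV])
  have degree: "out_degree (with_proj G) v = card {c. covers ?le c v} + (if v = l then 0 else 1)"
    if "v \<in> pverts G" for v
    using out_degree_hasse[OF that] unfolding hasse_graph_ancestor_order[OF T lV] .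
  have "out_degree (with_proj G) l = 1" using leaves l by blast
  then have "card {c. covers ?le c l} = 1" using degree[OF lV] by simp
  then obtain v0 where v0: "{c. covers ?le c l} = {v0}" by (meson card_1_singletonE)
  interpret W: tree_order ?W v0 "order_on ?W ?le" by (rule delete_root(1)[OF v0])
  have child: "{c. covers (order_on ?W ?le) c v} = {c. covers ?le c v}" if "v \<in> ?W" for v
    using delete_root(2)[OF v0] that by blast
  have leaf_iff: "v \<in> {1..n} \<longleftrightarrow> card {c. covers ?le c v} = 0" if "v \<in> ?W" for v
  proof -
    have "v \<in> {1..n} \<longleftrightarrow> out_degree (with_proj G) v = 1" using leaves that by blast
    then show ?thesis using degree[of v] that by simp
  qed
  have "binary_tree_order ?W v0 (order_on ?W ?le) ({1..n} - {l})"
  proof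
    have "(\<forall>x. order_on ?W ?le x v \<longrightarrow> x = v) \<longleftrightarrow> v \<in> {1..n}" if "v \<in> ?W" for v
      unfolding leaf_iff[OF that] W.children_empty_iff[symmetric] child[OF that]
      using finite_children by simp
    moreover have "{1..n} \<subseteq> pverts G" using leaves by blast
    ultimately show "{v \<in> ?W. \<forall>x. order_on ?W ?le x v \<longrightarrow> x = v} = {1..n} - {l}" by blast
  next
    fix v assume v: "v \<in> ?W" "v \<notin> {1..n} - {l}"
    then have "out_degree (with_proj G) v = 3" using inner by blast
    then have "card {c. covers ?le c v} = 2" using degree[of v] v by simp
    then show "card {c. covers (order_on ?W ?le) c v} = 2" using child v by simp
  qed
  then show thesis using v0 that by blast
qed

definition unrooted_clusters :: "nat \<Rightarrow> nat \<Rightarrow> nat pair_pre_digraph \<Rightarrow> nat set set" where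
  "unrooted_clusters n l G = leaf_cluster (ancestor_order G l) ({1..n} - {l}) ` (pverts G - {l})"

lemma leaf_cluster_order_on:
  "L \<subseteq> W \<Longrightarrow> leaf_cluster (order_on W le) L ` W = leaf_cluster le L ` W"
  by (rule image_cong[OF refl]) (auto simp: leaf_cluster_def order_on_def)

lemma unrooted_clusters_order_on:
  assumes "G \<in> unrooted_binary_trees n"
  shows "unrooted_clusters n l G =
    leaf_cluster (order_on (pverts G - {l}) (ancestor_order G l)) ({1..n} - {l}) ` (pverts G - {l})"
  using assms unfolding unrooted_clusters_def
  by (intro leaf_cluster_order_on[symmetric]) (auto simp: unrooted_binary_trees_def)

lemma binary_hierarchy_unrooted_clusters:
  assumes "G \<in> unrooted_binary_trees n" "l \<in> {1..n}"
  shows "binary_hierarchy ({1..n} - {l}) (unrooted_clusters n l G)"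
  unfolding unrooted_clusters_order_on[OF assms(1)]
  using unrooted_binary_tree_order[OF assms] binary_tree_order.binary_hierarchy_clusters by metis

lemma unrooted_iso_iff:
  assumes l: "l \<in> {1..n}"
  shows "(G, H) \<in> unrooted_iso n \<longleftrightarrow> G \<in> unrooted_binary_trees n \<and> H \<in> unrooted_binary_trees n \<and>
     unrooted_clusters n l G = unrooted_clusters n l H"
proof (cases "G \<in> unrooted_binary_trees n \<and> H \<in> unrooted_binary_trees n")
  case True
  then have GH: "G \<in> unrooted_binary_trees n" "H \<in> unrooted_binary_trees n" by auto
  then have T: "undirected_tree G" "undirected_tree H" and sub: "{1..n} \<subseteq> pverts G" "{1..n} \<subseteq> pverts H"
    by (auto simp: unrooted_binary_trees_def)
  then have V: "l \<in> pverts G" "l \<in> pverts H" using l by auto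
  interpret A: tree_order "pverts G" l "ancestor_order G l" by (rule tree_order_ancestor_order[OF T(1) V(1)])
  interpret B: tree_order "pverts H" l "ancestor_order H l" by (rule tree_order_ancestor_order[OF T(2) V(2)])
  have "unrooted_clusters n l G = unrooted_clusters n l H" if i: "iso_fixing {1..n} G H i" for i
  proof -
    note iso = iso_fixing_ancestor_order[OF T i V(1)]
    have fixed: "iso_verts i x = x" if "x \<in> {1..n}" for x using i that by (simp add: iso_fixing_def)
    have "pverts H - {l} = iso_verts i ` (pverts G - {l})"
      using iso(1,2) fixed[OF l] V by (auto simp: inj_on_def)
    then have "leaf_cluster (ancestor_order H l) ({1..n} - {l}) ` (pverts H - {l}) =
        leaf_cluster (ancestor_order G l) ({1..n} - {l}) ` (pverts G - {l})"
      using fixed iso(3) sub fixed[OF l] by (intro leaf_cluster_image_iso[of _ "iso_verts i"]) auto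
    then show ?thesis by (simp add: unrooted_clusters_def)
  qed
  moreover have "\<exists>i. iso_fixing {1..n} G H i" if eq: "unrooted_clusters n l G = unrooted_clusters n l H"
  proof -
    obtain v0 where v0: "binary_tree_order (pverts G - {l}) v0
        (order_on (pverts G - {l}) (ancestor_order G l)) ({1..n} - {l})"
      using unrooted_binary_tree_order[OF GH(1) l] by blast
    obtain w0 where w0: "binary_tree_order (pverts H - {l}) w0
        (order_on (pverts H - {l}) (ancestor_order H l)) ({1..n} - {l})"
      using unrooted_binary_tree_order[OF GH(2) l] by blast
    obtain h where h: "bij_betw h (pverts G - {l}) (pverts H - {l})" "\<forall>x\<in>{1..n} - {l}. h x = x"
      "\<forall>x\<in>pverts G - {l}. \<forall>y\<in>pverts G - {l}. order_on (pverts H - {l}) (ancestor_order H l) (h x) (h y) \<longleftrightarrow>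
         order_on (pverts G - {l}) (ancestor_order G l) x y"
      using binary_tree_order_iso[OF v0 w0] eq
      unfolding unrooted_clusters_order_on[OF GH(1)] unrooted_clusters_order_on[OF GH(2)] by blast
    define h' where "h' = h(l := l)"
    have hH: "h x \<in> pverts H - {l}" if "x \<in> pverts G - {l}" for x
      using h(1) that by (auto simp: bij_betw_def)
    have "bij_betw h' (pverts G - {l}) (pverts H - {l})"
      using h(1) bij_betw_cong[of "pverts G - {l}" h h'] by (simp add: h'_def)
    then have "bij_betw h' (pverts G - {l} \<union> {l}) (pverts H - {l} \<union> {h' l})"
      by (intro notIn_Un_bij_betw) (simp_all add: h'_def)
    then have "bij_betw h' (pverts G) (pverts H)" using V by (simp add: h'_def insert_absorb)
    moreover have "ancestor_order H l (h' x) (h' y) \<longleftrightarrow> ancestor_order G l x y"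
      if "x \<in> pverts G" "y \<in> pverts G" for x y
    proof (cases "x = l \<or> y = l")
      case True
      have "ancestor_order H l l z \<longleftrightarrow> z = l" for z
        using B.le_root[of z] B.le_in B.le_antisym V B.le_refl by blast
      moreover have "ancestor_order G l l z \<longleftrightarrow> z = l" for z
        using A.le_root[of z] A.le_in A.le_antisym V A.le_refl by blast
      moreover have "ancestor_order G l x l" "ancestor_order H l (h' x) l"
        using A.le_root B.le_root that hH V by (auto simp: h'_def)
      ultimately show ?thesis using True that hH by (auto simp: h'_def)
    next
      case False
      then show ?thesis using h(3) hH that by (auto simp: h'_def order_on_def)
    qed
    ultimately have "\<exists>i. iso_fixing {1..n} (hasse_graph (pverts G) (ancestor_order G l))
        (hasse_graph (pverts H) (ancestor_order H l)) i \<and> iso_verts i = h'"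
      using h(2)
      by (intro hasse_graph_iso[OF A.tree_order_axioms B.tree_order_axioms]) (auto simp: h'_def)
    then show ?thesis
      unfolding hasse_graph_ancestor_order[OF T(1) V(1)] hasse_graph_ancestor_order[OF T(2) V(2)] by blast
  qed
  ultimately show ?thesis using True by (auto simp: unrooted_iso_def)
qed (auto simp: unrooted_iso_def)

section \<open>Realising a hierarchy by an unrooted tree\<close>

text \<open>
  A leaf has to be its own label, so singletons are sent to their element. The other clusters may
  get any new numbers.
\<close>

lemma inj_vertex_labels:
  assumes "finite H" "finite B"
  shows "\<exists>f :: nat set \<Rightarrow> nat. inj_on f H \<and> (\<forall>x. f {x} = x) \<and> (\<forall>C\<in>H. (\<nexists>x. C = {x}) \<longrightarrow> f C \<notin> B)"
proof -
  obtain g :: "nat set \<Rightarrow> nat" where g: "inj_on g H" using finite_imp_inj_to_nat_seg[OF assms(1)] by blast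
  \<comment> \<open>The labels of the larger clusters start above \<open>B\<close> and above all labels of singletons.\<close>
  define N where "N = Suc (Max (insert 0 (B \<union> \<Union> {C \<in> H. finite C})))"
  have fin: "finite (B \<union> \<Union> {C \<in> H. finite C})" using assms by auto
  have N: "b < N" if "b \<in> B \<union> \<Union> {C \<in> H. finite C}" for b
    unfolding N_def using Max_ge[of "insert 0 (B \<union> \<Union> {C \<in> H. finite C})" b] fin that by (simp add: less_Suc_eq_le)
  define f where "f C = (if \<exists>x. C = {x} then the_elem C else N + g C)" for C
  have "inj_on f H"
  proof (rule inj_onI)
    fix C D assume CD: "C \<in> H" "D \<in> H" "f C = f D"
    have small: "f E < N" if "E \<in> H" "E = {x}" for E x
      using N[of x] that by (force simp: f_def)
    show "C = D"
    proof (cases "(\<exists>x. C = {x}) \<or> (\<exists>x. D = {x})")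
      case True
      then obtain x y where "C = {x}" "D = {y}"
        using small[of C] small[of D] CD by (force simp: f_def split: if_splits)
      then show ?thesis using CD by (simp add: f_def)
    next
      case False
      then show ?thesis using CD g by (auto simp: f_def dest: inj_onD)
    qed
  qed
  moreover have "f C \<notin> B" if "\<nexists>x. C = {x}" for C
    using N[of "f C"] that by (auto simp: f_def)
  ultimately show ?thesis by (intro exI[of _ f]) (auto simp: f_def)
qed

lemma binary_tree_order_exists:
  assumes h: "binary_hierarchy L H" and L: "finite L" and l: "l \<notin> L"
  shows "\<exists>V r le. binary_tree_order V r le L \<and> l \<notin> V \<and> leaf_cluster le L ` V = H"
proof -
  have finH: "finite H" using finite_binary_hierarchy[OF L h] .
  obtain f :: "nat set \<Rightarrow> nat" where f: "inj_on f H" "\<forall>x. f {x} = x"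
    "\<forall>C\<in>H. (\<nexists>x. C = {x}) \<longrightarrow> f C \<notin> {l}"
    using inj_vertex_labels[OF finH, of "{l}"] by auto
  define V where "V = f ` H"
  define g where "g = the_inv_into H f"
  define le where "le x y \<longleftrightarrow> x \<in> V \<and> y \<in> V \<and> g x \<subseteq> g y" for x y
  have g: "bij_betw g V H" unfolding g_def V_def
    by (rule bij_betw_the_inv_into) (use f(1) in \<open>simp add: bij_betw_def\<close>)
  have gf: "g (f C) = C" if "C \<in> H" for C unfolding g_def using f(1) that by (rule the_inv_into_f_f)
  have gH: "g x \<in> H" if "x \<in> V" for x using g that by (auto simp: bij_betw_def)
  have leaf: "x \<in> V \<and> g x = {x}" if "x \<in> L" for x
    using binary_hierarchyD(4)[OF h that] gf[of "{x}"] f(2) by (force simp: V_def)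
  interpret tree_order V "f L" le
  proof
    show "finite V" using finH by (simp add: V_def)
    show "f L \<in> V" using binary_hierarchyD(3)[OF h] by (simp add: V_def)
    show "le x (f L)" if "x \<in> V" for x
      using binary_hierarchyD(1)[OF h gH[OF that]] binary_hierarchyD(3)[OF h] gf that
      by (auto simp: le_def V_def)
    show "x = y" if "le x y" "le y x" for x y
      using that g unfolding le_def bij_betw_def by (metis inj_onD subset_antisym)
    show "le y z \<or> le z y" if "le x y" "le x z" for x y z
      using that binary_hierarchyD(5)[OF h gH gH, of y z] binary_hierarchyD(2)[OF h gH, of x]
      unfolding le_def by blast
  qed (auto simp: le_def)
  have "binary_tree_order V (f L) le L" "leaf_cluster le L ` V = H"
    by (rule binary_tree_orderI[OF h g]; use leaf in \<open>simp add: le_def\<close>)+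
  moreover have "l \<notin> V"
  proof
    assume "l \<in> V"
    then obtain C where C: "C \<in> H" "l = f C" by (auto simp: V_def)
    then obtain x where "C = {x}" using f(3) by auto
    then show False using C f(2) binary_hierarchyD(1)[OF h C(1)] l by auto
  qed
  ultimately show ?thesis by blast
qed

text \<open>
  This undoes the deletion of the root: \<open>l\<close> becomes a new top element whose only child is the old
  root.
\<close>

lemma (in tree_order) add_root:
  assumes l: "l \<notin> V"
  defines "le' x y \<equiv> le x y \<or> (x \<in> insert l V \<and> y = l)"
  shows "tree_order (insert l V) l le'" "order_on V le' = le"
    and "covers le' x y \<longleftrightarrow> covers le x y \<or> (x = r \<and> y = l)"
proof -
  have le'_l: "le' x l \<longleftrightarrow> x \<in> insert l V" "le' l x \<longleftrightarrow> x = l" for x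
    using l le_in unfolding le'_def by blast+
  have le'_V: "le' x y \<longleftrightarrow> le x y" if "y \<noteq> l" for x y using that unfolding le'_def by blast
  show "tree_order (insert l V) l le'"
  proof
    show "finite (insert l V)" using finite_V by simp
    show "x \<in> insert l V \<and> y \<in> insert l V" if "le' x y" for x y
      using that le_in unfolding le'_def by blast
    show "x = y" if "le' x y" "le' y x" for x y
      using that le_antisym l le_in unfolding le'_def by blast
    show "le' x z" if "le' x y" "le' y z" for x y z
      using that le_trans l le_in unfolding le'_def by blast
    show "le' y z \<or> le' z y" if "le' x y" "le' x z" for x y z
      using that le_chain l le_in unfolding le'_def by blast
  qed (use le_refl in \<open>auto simp: le'_def\<close>)
  show "order_on V le' = le"
    using l le_in unfolding le'_def order_on_def by (intro ext) blast
  show "covers le' x y \<longleftrightarrow> covers le x y \<or> (x = r \<and> y = l)"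
  proof (cases "y = l")
    case True
    have "\<not> covers le x l" using l le_in unfolding covers_def by blast
    moreover have "covers le' x l \<longleftrightarrow> x = r"
    proof
      assume c: "covers le' x l"
      then have "x \<in> V" using le'_l unfolding covers_def by blast
      then have "le' x r" "le' r l" "r \<noteq> l"
        using le_root root_in l unfolding le'_def by blast+
      then show "x = r" using c unfolding covers_def by blast
    next
      assume "x = r"
      moreover have "z = r" if "le r z" for z using that le_root le_in le_antisym by blast
      ultimately show "covers le' x l"
        using root_in l unfolding covers_def le'_def by blast
    qed
    ultimately show ?thesis using True by blast
  next
    case False
    have "z \<noteq> l" if "le' z y" for z using that False le'_l by blast
    then show ?thesis using False le'_V unfolding covers_def by blast
  qed
qed

lemma unrooted_clusters_surj:
  assumes h: "binary_hierarchy ({1..n} - {l}) H" and l: "l \<in> {1..n}"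
  shows "\<exists>G\<in>unrooted_binary_trees n. unrooted_clusters n l G = H"
proof -
  let ?L = "{1..n} - {l}"
  obtain V r le where B: "binary_tree_order V r le ?L" and lV: "l \<notin> V"
    and H: "leaf_cluster le ?L ` V = H"
    using binary_tree_order_exists[OF h, of l] by auto
  interpret binary_tree_order V r le ?L by (rule B)
  define le' where "le' x y \<longleftrightarrow> le x y \<or> (x \<in> insert l V \<and> y = l)" for x y
  interpret P: tree_order "insert l V" l le'
    using add_root(1)[OF lV] unfolding le'_def .
  have cov: "covers le' x y \<longleftrightarrow> covers le x y \<or> (x = r \<and> y = l)" for x y
    using add_root(3)[OF lV] unfolding le'_def .
  define G where "G = hasse_graph (insert l V) le'"
  have T: "undirected_tree G" unfolding G_def by (rule P.undirected_tree_hasse)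
  have anc: "ancestor_order G l = le'" unfolding G_def by (rule P.ancestor_order_hasse)
  have pv: "pverts G = insert l V" by (simp add: G_def)
  have "\<not> covers le x l" for x using lV le_in coversD(1) by blast
  then have "{c. covers le' c l} = {r}" using cov by auto
  then have deg_l: "out_degree (with_proj G) l = 1"
    using P.out_degree_hasse[of l] by (simp add: G_def)
  have deg: "out_degree (with_proj G) v = card {c. covers le c v} + 1" if "v \<in> V" for v
  proof -
    have "v \<noteq> l" using that lV by blast
    then have "{c. covers le' c v} = {c. covers le c v}" using cov by simp
    then show ?thesis using P.out_degree_hasse[of v] that \<open>v \<noteq> l\<close> by (simp add: G_def)
  qed
  have deg_leaf: "out_degree (with_proj G) v = 1" if "v \<in> ?L" for v
  proof -
    have "{c. covers le c v} = {}" using below_leaf[OF that] children_empty_iff by blast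
    then show ?thesis using deg[OF leaf_in[OF that]] by (simp only: card.empty)
  qed
  have deg_inner: "out_degree (with_proj G) v = 3" if "v \<in> V" "v \<notin> ?L" for v
    using deg[OF that(1)] card_children[OF that] by simp
  have sub: "?L \<subseteq> V" using leaf_in by blast
  have "{v \<in> pverts G. out_degree (with_proj G) v = 1} = {1..n}"
  proof (intro set_eqI iffI)
    fix v assume "v \<in> {v \<in> pverts G. out_degree (with_proj G) v = 1}"
    then show "v \<in> {1..n}" using deg_inner[of v] l pv by (cases "v = l") auto
  next
    fix v assume "v \<in> {1..n}"
    then show "v \<in> {v \<in> pverts G. out_degree (with_proj G) v = 1}"
      using deg_l deg_leaf[of v] sub pv by (cases "v = l") auto
  qed
  moreover have "\<forall>v\<in>pverts G - {1..n}. out_degree (with_proj G) v = 3"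
    using deg_inner l pv by auto
  ultimately have G: "G \<in> unrooted_binary_trees n" using T by (simp add: unrooted_binary_trees_def)
  have "pverts G - {l} = V" using pv lV by auto
  moreover have "order_on V le' = le" using add_root(2)[OF lV] unfolding le'_def .
  ultimately have "unrooted_clusters n l G = H"
    unfolding unrooted_clusters_order_on[OF G] anc using H by simp
  then show ?thesis using G by blast
qed

section \<open>Contracting a tree to a branching-closed set of vertices\<close>

text \<open>
  A path without inner vertices in \<open>K\<close> avoids the branching vertices in its interior and therefore
  cannot turn from upwards to downwards. So its ends are comparable, it consists of the vertices
  between them, and no inner one lies in \<open>K\<close> exactly if one end covers the other within \<open>K\<close>.
\<close>

lemma (in tree_order) gen_contr_graph_hasse:
  assumes K: "K \<subseteq> V" and branching: "\<And>v c d. covers le c v \<Longrightarrow> covers le d v \<Longrightarrow> c \<noteq> d \<Longrightarrow> v \<in> K"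
  shows "gen_contr_graph (with_proj (hasse_graph V le)) K = hasse_graph K (order_on K le)"
proof -
  interpret G: pair_graph "hasse_graph V le" by (rule pair_graph_hasse)
  \<comment> \<open>If a walk steps up to \<open>y\<close> and ends strictly below \<open>y\<close>, it ends below the child it came from:
    otherwise \<open>y\<close> would have two children and lie in \<open>K\<close>.\<close>
  have comparable: "le u v \<or> le v u" if "G.awalk u p v" "set (G.inner_verts p) \<inter> K = {}" for u p v
    using that
  proof (induction p arbitrary: u)
    case Nil
    then show ?case using le_refl by (auto simp: G.awalk_Nil_iff)
  next
    case (Cons e p)
    obtain y where e: "e = (u, y)" "covers le u y \<or> covers le y u" and y: "G.awalk y p v"
      using Cons.prems(1) by (cases e) (auto simp: G.awalk_Cons_iff)
    show ?case
    proof (cases "p = []")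
      case True
      then show ?thesis using y e coversD by (auto simp: G.awalk_Nil_iff)
    next
      case False
      then have inner: "G.inner_verts (e # p) = y # G.inner_verts p"
        using G.inner_verts_Cons[OF Cons.prems(1)] e by simp
      then have "y \<notin> K" "le y v \<or> le v y" using Cons y by auto
      show ?thesis
      proof (cases "y = v")
        case True then show ?thesis using e coversD by blast
      next
        case False
        from e(2) show ?thesis
        proof
          assume up: "covers le u y"
          show ?thesis
          proof (cases "le y v")
            case True then show ?thesis using up coversD le_trans by blast
          next
            case nle: False
            then obtain c where c: "covers le c y" "le v c"
              using child_exists[of v y] \<open>le y v \<or> le v y\<close> False by blast
            then have "c = u" using branching[OF c(1) up] \<open>y \<notin> K\<close> by blast
            then show ?thesis using c by blast
          qed
        next
          assume down: "covers le y u"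
          show ?thesis
            using \<open>le y v \<or> le v y\<close> covers_below[OF down] False coversD(1)[OF down] le_trans by blast
        qed
      qed
    qed
  qed
  have path: "G.gen_iapath K u p v \<longleftrightarrow> covers (order_on K le) u v" if p: "G.apath u p v" and uv: "le u v" for u p v
  proof -
    obtain q where q: "G.apath u q v" "set (pawalk_verts u q) = {y. le u y \<and> le y v}"
      using up_path_exists[OF uv] by blast
    have "p = q" using tree_apath_unique[OF undirected_tree_hasse p q(1)] .
    then have inner: "set (G.inner_verts p) = {y. le u y \<and> le y v} - {u, v}"
      using G.set_inner_verts[OF p] q(2) by simp
    have "p \<noteq> [] \<longleftrightarrow> u \<noteq> v" using p G.apath_nonempty_ends by (auto simp: G.apath_Nil_iff)
    then show ?thesis
      using p uv inner unfolding G.gen_iapath_def covers_def order_on_def by blast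
  qed
  have "(\<exists>p. G.gen_iapath K u p v) \<longleftrightarrow> covers (order_on K le) u v \<or> covers (order_on K le) v u" for u v
  proof
    assume "\<exists>p. G.gen_iapath K u p v"
    then obtain p where p: "G.gen_iapath K u p v" by blast
    then have ap: "G.apath u p v" "set (G.inner_verts p) \<inter> K = {}" by (auto simp: G.gen_iapath_def)
    from comparable[OF G.awalkI_apath[OF ap(1)] ap(2)]
    show "covers (order_on K le) u v \<or> covers (order_on K le) v u"
    proof
      assume "le u v" then show ?thesis using path[OF ap(1)] p by blast
    next
      assume vu: "le v u"
      have "G.gen_iapath K v (rev_path p) u" "G.apath v (rev_path p) u"
        using p ap by (simp_all add: G.gen_iapath_rev_path)
      then show ?thesis using path vu by blast
    qed
  next
    have up: "\<exists>p. G.gen_iapath K u p v" if "covers (order_on K le) u v" for u v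
    proof -
      have "le u v" using that by (auto simp: covers_def order_on_def)
      then show ?thesis using path up_path_exists[OF \<open>le u v\<close>] that by blast
    qed
    assume "covers (order_on K le) u v \<or> covers (order_on K le) v u"
    then show "\<exists>p. G.gen_iapath K u p v"
      using up G.gen_iapath_rev_path by blast
  qed
  then show ?thesis unfolding gen_contr_graph_def hasse_graph_def by simp
qed

section \<open>The induced tree\<close>

lemma find_least:
  assumes "sorted_wrt R xs" "w \<in> set xs" "P w" "\<And>x. x \<in> set xs \<Longrightarrow> P x \<Longrightarrow> \<not> R x w"
  shows "find P xs = Some w"
  using assms by (induction xs) auto

text \<open>
  The upper bounds of a nonempty set form a chain.
\<close>

lemma (in tree_order) sup_exists:
  assumes "s \<in> S" "le s v" "\<And>t. t \<in> S \<Longrightarrow> le t v"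
  obtains w where "\<And>t. t \<in> S \<Longrightarrow> le t w" "\<And>u. (\<And>t. t \<in> S \<Longrightarrow> le t u) \<Longrightarrow> le w u"
proof -
  let ?U = "\<lambda>u. \<forall>t\<in>S. le t u"
  obtain w where w: "?U w" and least: "\<And>u. ?U u \<Longrightarrow> card {z. le z w} \<le> card {z. le z u}"
    using ex_has_least_nat[of ?U v "\<lambda>u. card {z. le z u}"] assms(3) by blast
  have "le w u" if u: "?U u" for u
  proof -
    have "le w u \<or> le u w" using le_chain w u assms(1) by blast
    then show ?thesis using card_down_less[of u w] least[OF u] w assms(1) le_refl le_in
      by (metis linorder_not_less)
  qed
  then show thesis using that w by blast
qed

lemma restrict_unrooted_clusters:
  assumes "S \<subseteq> {1..n} - {l}"
  shows "restrict_hierarchy S (unrooted_clusters n l G) =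
    leaf_cluster (ancestor_order G l) S ` (pverts G - {l}) - {{}}"
proof -
  have "leaf_cluster le ({1..n} - {l}) v \<inter> S = leaf_cluster le S v" for le v
    using assms by (auto simp: leaf_cluster_def)
  then show ?thesis unfolding restrict_hierarchy_def unrooted_clusters_def image_image by simp
qed

text \<open>
  Let \<open>G\<close> hang from \<open>l\<close>. The paths from \<open>S\<close> to the neighbour \<open>v0\<close> of \<open>l\<close> all lead upwards, so their
  first common vertex is the least upper bound \<open>w\<close> of \<open>S\<close>. The union of the paths from \<open>w\<close> to \<open>S\<close>
  consists of the vertices \<open>U\<close> between \<open>S\<close> and \<open>w\<close>. Suppression keeps the set \<open>K\<close> of those vertices
  of \<open>U\<close> that are leaves or have two children in \<open>U\<close>, and joins neighbours in the order on \<open>K\<close>. It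
  remains to see that the map \<open>g\<close>, which sends \<open>v\<close> to the trace of its cluster on \<open>S\<close>, is an order
  isomorphism from \<open>K\<close> onto the restricted hierarchy.
\<close>

lemma induced_tree_clusters:
  assumes G: "G \<in> unrooted_binary_trees n" and l: "l \<in> {1..n}" and S: "S \<subseteq> {1..n} - {l}" "1 < card S"
  shows "induced_tree l S G \<in> rooted_binary_trees S"
    and "rooted_clusters S (induced_tree l S G) = restrict_hierarchy S (unrooted_clusters n l G)"
proof -
  have T: "undirected_tree G" and lV: "l \<in> pverts G"
    using G l by (auto simp: unrooted_binary_trees_def)
  define le where "le = ancestor_order G l"
  define V where "V = pverts G"
  interpret tree_order V l le unfolding V_def le_def by (rule tree_order_ancestor_order[OF T lV])
  have hasse: "hasse_graph V le = G" unfolding V_def le_def by (rule hasse_graph_ancestor_order[OF T lV])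
  obtain v0 where v0: "{c. covers le c l} = {v0}"
    and B: "binary_tree_order (V - {l}) v0 (order_on (V - {l}) le) ({1..n} - {l})"
    using unrooted_binary_tree_order[OF G l] unfolding V_def le_def .
  interpret W: binary_tree_order "V - {l}" v0 "order_on (V - {l}) le" "{1..n} - {l}" by (rule B)
  have not_l: "x \<noteq> l" if "le x y" "y \<noteq> l" for x y
    using that le_root le_in le_antisym by blast
  have W_le: "order_on (V - {l}) le x y \<longleftrightarrow> le x y" if "y \<noteq> l" for x y
    using that not_l le_in unfolding order_on_def by blast
  have v0_l: "v0 \<noteq> l" "covers le v0 l" using v0 coversD by blast+
  have S_V: "s \<in> V - {l}" if "s \<in> S" for s using W.leaf_in S that by blast
  have S_v0: "le s v0" if "s \<in> S" for s using W.le_root[OF S_V[OF that]] W_le[OF v0_l(1)] by blast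
  have S_min: "u = s" if "s \<in> S" "le u s" for u s
    using W.below_leaf[of s u] S that W_le[of s u] S_V[OF that(1)] by blast
  have finS: "finite S" using S(2) card.infinite by fastforce
  obtain s0 where s0: "s0 \<in> S" using S(2) by (metis card.empty ex_in_conv not_less_zero)
  obtain w where w: "\<And>t. t \<in> S \<Longrightarrow> le t w" "\<And>u. (\<And>t. t \<in> S \<Longrightarrow> le t u) \<Longrightarrow> le w u"
    using sup_exists[OF s0 S_v0[OF s0] S_v0] by blast
  have w_v0: "le w v0" using w(2) S_v0 by blast
  have w_l: "w \<noteq> l" using not_l w_v0 v0_l by blast
  have w_S: "w \<notin> S"
  proof
    assume "w \<in> S"
    then have "S \<subseteq> {w}" using S_min w(1) by blast
    then show False using S(2) card_mono[of "{w}" S] by simp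
  qed

  have attach: "attach_vertex G l = v0"
  proof -
    have "(l, v) \<in> parcs G \<longleftrightarrow> v = v0" for v
    proof -
      have "(l, v) \<in> parcs G \<longleftrightarrow> covers le l v \<or> covers le v l"
        using hasse_graph_simps(2)[of l v V le] unfolding hasse .
      moreover have "\<not> covers le l v" using le_root le_in le_antisym coversD by blast
      moreover have "covers le v l \<longleftrightarrow> v = v0" using v0 by (simp add: set_eq_iff)
      ultimately show ?thesis by blast
    qed
    then show ?thesis unfolding attach_vertex_def by simp
  qed
  have fcv: "first_common_vertex G S v0 = w"
  proof -
    have verts: "set (tree_path_verts G s v0) = {y. le s y \<and> le y v0}" if "s \<in> S" for s
      using tree_path_up(2)[OF S_v0[OF that]] unfolding hasse .
    have "find (\<lambda>x. \<forall>t\<in>S. x \<in> set (tree_path_verts G t v0)) (tree_path_verts G s v0) = Some w"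
      if s: "s \<in> S" for s
    proof (rule find_least)
      show "sorted_wrt (\<lambda>y z. le y z \<and> y \<noteq> z) (tree_path_verts G s v0)"
        using tree_path_up(1)[OF S_v0[OF s]] unfolding hasse .
      show "w \<in> set (tree_path_verts G s v0)" "\<forall>t\<in>S. w \<in> set (tree_path_verts G t v0)"
        using verts w(1) w_v0 s by auto
      show "\<not> (le x w \<and> x \<noteq> w)" if "\<forall>t\<in>S. x \<in> set (tree_path_verts G t v0)" for x
        using that verts w(2)[of x] le_antisym by blast
    qed
    then show ?thesis unfolding first_common_vertex_def using s0 by (intro the_equality) force+
  qed

  define U where "U = {x. le x w \<and> (\<exists>s\<in>S. le s x)}"
  have U_V: "U \<subseteq> V" using le_in unfolding U_def by blast
  have wU: "w \<in> U" using w(1) s0 le_refl le_in unfolding U_def by blast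
  have U_covers: "covers (order_on U le) x y \<longleftrightarrow> covers le x y \<and> x \<in> U \<and> y \<in> U" for x y
  proof -
    have "z \<in> U" if "x \<in> U" "y \<in> U" "le x z" "le z y" for z
      using that le_trans unfolding U_def by blast
    then show ?thesis unfolding covers_def order_on_def by blast
  qed
  have union: "path_union G w S = hasse_graph U (order_on U le)"
  proof -
    have verts: "set (tree_path_verts G w s) = {y. le s y \<and> le y w}"
      and arcs: "set (tree_path G w s) = {(z, y). covers le y z \<and> le s y \<and> le z w}" if "s \<in> S" for s
      using tree_path_down[OF w(1)[OF that]] unfolding hasse by auto
    have "(\<Union>s\<in>S. set (tree_path_verts G w s)) = U"
      using verts unfolding U_def by auto
    moreover have "(x, y) \<in> (\<Union>s\<in>S. set (tree_path G w s) \<union> (set (tree_path G w s))\<inverse>) \<longleftrightarrow>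
        covers (order_on U le) x y \<or> covers (order_on U le) y x" for x y
    proof -
      have in_U: "(\<exists>s\<in>S. covers le x y \<and> le s x \<and> le y w) \<longleftrightarrow> covers le x y \<and> x \<in> U \<and> y \<in> U" for x y
        using coversD(1) le_trans unfolding U_def by blast
      have arc: "(z, y) \<in> set (tree_path G w s) \<longleftrightarrow> covers le y z \<and> le s y \<and> le z w" if "s \<in> S" for s y z
        using arcs[OF that] by simp
      have "(x, y) \<in> (\<Union>s\<in>S. set (tree_path G w s) \<union> (set (tree_path G w s))\<inverse>) \<longleftrightarrow>
          (\<exists>s\<in>S. covers le x y \<and> le s x \<and> le y w) \<or> (\<exists>s\<in>S. covers le y x \<and> le s y \<and> le x w)"
        using arc by blast
      then show ?thesis unfolding U_covers in_U by blast
    qed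
    ultimately show ?thesis
      unfolding path_union_def hasse_graph_def by auto
  qed
  interpret U: tree_order U w "order_on U le"
    using U_V wU by (rule tree_order_on) (auto simp: U_def)
  \<comment> \<open>One step down from \<open>x\<close> towards a vertex \<open>z\<close> above a leaf in \<open>S\<close> stays in \<open>U\<close>.\<close>
  have U_step: "\<exists>c. covers (order_on U le) c x \<and> le z c" if "x \<in> U" "le z x" "z \<noteq> x" "\<exists>s\<in>S. le s z" for x z
  proof -
    obtain c where c: "covers le c x" "le z c" using child_exists \<open>le z x\<close> \<open>z \<noteq> x\<close> by blast
    then have "c \<in> U" using that coversD(1)[OF c(1)] le_trans unfolding U_def by blast
    then show ?thesis using c that U_covers by blast
  qed

  define K where "K = {v \<in> U. v = w \<or> out_degree (with_proj (hasse_graph U (order_on U le))) v \<noteq> 2}"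
  \<comment> \<open>Apart from \<open>w\<close>, degree 2 means one child, because the parent is the other neighbour.\<close>
  have K_iff: "v \<in> K \<longleftrightarrow> v = w \<or> card {c. covers (order_on U le) c v} \<noteq> 1" if "v \<in> U" for v
    using U.out_degree_hasse[OF that] that unfolding K_def by auto
  have K_U: "K \<subseteq> U" and wK: "w \<in> K" using wU unfolding K_def by auto
  have K_on: "order_on K (order_on U le) = order_on K le"
    using K_U unfolding order_on_def by (intro ext) blast
  have induced: "induced_tree l S G = (hasse_graph K (order_on K le), w)"
  proof -
    have "gen_contr_graph (with_proj (hasse_graph U (order_on U le))) K = hasse_graph K (order_on K le)"
      unfolding K_on[symmetric]
    proof (rule U.gen_contr_graph_hasse[OF K_U])
      fix v c d assume cd: "covers (order_on U le) c v" "covers (order_on U le) d v" "c \<noteq> d"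
      have "{c, d} \<subseteq> {c. covers (order_on U le) c v}" using cd by blast
      then have "card {c, d} \<le> card {c. covers (order_on U le) c v}"
        by (rule card_mono[OF U.finite_children])
      then have "card {c. covers (order_on U le) c v} \<noteq> 1" using cd(3) by simp
      moreover have "v \<in> U" using U.coversD(1)[OF cd(1)] U.le_in by blast
      ultimately show "v \<in> K" using K_iff by blast
    qed
    then show ?thesis
      unfolding induced_tree_def attach fcv Let_def union suppress_degree_2_def
      by (simp add: K_def)
  qed

  define g where "g = leaf_cluster le S"
  define H where "H = restrict_hierarchy S (unrooted_clusters n l G)"
  have H: "H = g ` (V - {l}) - {{}}"
    unfolding H_def g_def V_def le_def by (rule restrict_unrooted_clusters[OF S(1)])
  have "S \<noteq> {}" using s0 by blast
  then have hier: "binary_hierarchy S H"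
    unfolding H_def using binary_hierarchy_unrooted_clusters[OF G l] S(1)
    by (intro binary_hierarchy_restrict) auto
  have g_mono: "g x \<subseteq> g y" if "le x y" for x y
    using that le_trans unfolding g_def leaf_cluster_def by blast
  have U_g: "g x \<noteq> {}" if "x \<in> U" for x using that unfolding U_def g_def leaf_cluster_def by blast
  have S_K: "s \<in> K \<and> g s = {s}" if s: "s \<in> S" for s
  proof
    have "s \<in> U" using s w(1) le_refl le_in unfolding U_def by blast
    moreover have "{c. covers (order_on U le) c s} = {}"
      unfolding U.children_empty_iff using S_min[OF s] unfolding order_on_def by blast
    ultimately show "s \<in> K" using K_iff by simp
    show "g s = {s}" using S_min[OF s] s S_V le_refl unfolding g_def leaf_cluster_def by blast
  qed
  \<comment> \<open>If \<open>x\<close> lies strictly above \<open>y\<close>, then besides the child \<open>c\<close> above \<open>y\<close> it has another child \<open>d\<close> in \<open>U\<close>,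
    and the leaves of \<open>S\<close> below \<open>d\<close> are in \<open>g x\<close> but not in \<open>g y\<close>.\<close>
  have g_iff: "le x y \<longleftrightarrow> g x \<subseteq> g y" if x: "x \<in> K" and y: "y \<in> K" for x y
  proof
    assume sub: "g x \<subseteq> g y"
    have U: "x \<in> U" "y \<in> U" using x y K_U by auto
    obtain s where s: "s \<in> S" "le s x" using U unfolding U_def by blast
    then have "le s y" using sub unfolding g_def leaf_cluster_def by blast
    show "le x y"
    proof (rule ccontr)
      assume not: "\<not> le x y"
      then have yx: "le y x" "y \<noteq> x" using le_chain[OF s(2) \<open>le s y\<close>] le_refl U U_V by blast+
      then obtain c where c: "covers (order_on U le) c x" "le y c"
        using U_step[OF U(1) yx] U(2) unfolding U_def by blast
      have "\<exists>d. covers (order_on U le) d x \<and> d \<noteq> c"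
      proof (cases "x = w")
        case True
        have "\<not> le w c" using c(1) True U.coversD le_antisym unfolding order_on_def by blast
        then obtain t where t: "t \<in> S" "\<not> le t c" using w(2) by blast
        then obtain d where "covers (order_on U le) d w" "le t d"
          using U_step[OF wU w(1)[OF t(1)]] w_S S_V le_refl by blast
        then show ?thesis using t True by blast
      next
        case False
        then have "card {c. covers (order_on U le) c x} \<noteq> 1" using K_iff[OF U(1)] x by blast
        moreover have "{c. covers (order_on U le) c x} = {c}"
          if "\<nexists>d. covers (order_on U le) d x \<and> d \<noteq> c" using that c(1) by blast
        ultimately show ?thesis by fastforce
      qed
      then obtain d where d: "covers (order_on U le) d x" "d \<noteq> c" by blast
      have d': "covers le d x" "d \<in> U" and c': "covers le c x" using d(1) c(1) U_covers by blast+
      obtain t where t: "t \<in> S" "le t d" using d'(2) unfolding U_def by blast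
      then have "le t x" using coversD(1)[OF d'(1)] le_trans by blast
      then have "le t y" using sub t(1) unfolding g_def leaf_cluster_def by blast
      then have "le t c" using c(2) le_trans by blast
      then show False using siblings_disjoint[OF d'(1) c' d(2) t(2)] by blast
    qed
  qed (rule g_mono)
  have surj: "D \<in> g ` K" if D: "D \<in> H" for D
  proof -
    obtain u where u: "u \<in> V - {l}" "D = g u" "D \<noteq> {}" using D unfolding H by blast
    then obtain s where s: "s \<in> S" "le s u" unfolding g_def leaf_cluster_def by blast
    \<comment> \<open>Every trace \<open>D\<close> occurs in \<open>U\<close>, and the lowest vertex of \<open>U\<close> with trace \<open>D\<close> is kept: an only
      child would have the same trace.\<close>
    have "\<exists>x. x \<in> U \<and> g x = D"
    proof (cases "le u w")
      case True
      then show ?thesis using u s unfolding U_def by blast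
    next
      case False
      then have "le w u" using le_chain[OF s(2) w(1)[OF s(1)]] by blast
      then have "g u = S" "g w = S" using w(1) le_trans unfolding g_def leaf_cluster_def by blast+
      then show ?thesis using wU u by blast
    qed
    then obtain x0 where x0: "x0 \<in> U \<and> g x0 = D" by blast
    obtain v where v: "v \<in> U" "g v = D"
      and least: "\<And>x. x \<in> U \<and> g x = D \<Longrightarrow> card {z. le z v} \<le> card {z. le z x}"
      using ex_has_least_nat[of "\<lambda>x. x \<in> U \<and> g x = D" x0 "\<lambda>x. card {z. le z x}", OF x0] by blast
    have "v \<in> K"
    proof (rule ccontr)
      assume nK: "v \<notin> K"
      then have "card {c. covers (order_on U le) c v} = 1" using K_iff[OF v(1)] by blast
      then obtain c where c: "{c. covers (order_on U le) c v} = {c}" by (meson card_1_singletonE)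
      then have cov: "covers le c v" "c \<in> U" using U_covers by blast+
      have "le s c" if s: "s \<in> S" "le s v" for s
      proof -
        have "s \<noteq> v" using S_K s nK by blast
        then obtain d where "covers (order_on U le) d v" "le s d"
          using U_step[OF v(1) s(2)] s(1) S_V le_refl by blast
        then show ?thesis using c by (simp add: set_eq_iff)
      qed
      then have "g v \<subseteq> g c" unfolding g_def leaf_cluster_def by blast
      then have "g c = D" using g_mono[OF coversD(1)[OF cov(1)]] v(2) by blast
      then show False using least[of c] cov card_down_less[OF coversD[OF cov(1)]] by simp
    qed
    then show ?thesis using v(2) by blast
  qed
  have "g ` K \<subseteq> H"
  proof -
    have "K \<subseteq> V - {l}" using K_U w_l not_l U_V unfolding U_def by blast
    then show ?thesis unfolding H using U_g K_U by blast
  qed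
  moreover have "inj_on g K"
  proof (rule inj_onI)
    fix x y assume "x \<in> K" "y \<in> K" "g x = g y"
    then have "le x y" "le y x" using g_iff[of x y] g_iff[of y x] by simp_all
    then show "x = y" by (rule le_antisym)
  qed
  ultimately have bij: "bij_betw g K H" using surj unfolding bij_betw_def by blast
  interpret K: tree_order K w "order_on K le"
    using K_U U_V wK unfolding U_def by (intro tree_order_on) auto
  have BK: "binary_tree_order K w (order_on K le) S" "leaf_cluster (order_on K le) S ` K = H"
    by (rule K.binary_tree_orderI[OF hier bij]; use g_iff S_K in \<open>simp add: order_on_def\<close>)+
  show "induced_tree l S G \<in> rooted_binary_trees S"
    unfolding induced rooted_binary_trees_iff K.ancestor_order_hasse
    using K.undirected_tree_hasse wK BK(1) by simp
  show "rooted_clusters S (induced_tree l S G) = restrict_hierarchy S (unrooted_clusters n l G)"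
    unfolding induced rooted_clusters_def case_prod_conv K.ancestor_order_hasse
    using BK(2) by (simp add: H_def)
qed

section \<open>Counting isomorphism classes\<close>

lemma double_fact_pos: "0 < double_fact n"
  by (induction n rule: double_fact.induct) auto

lemma pair_pmf_of_set:
  assumes "finite A" "A \<noteq> {}" "finite B" "B \<noteq> {}"
  shows "pair_pmf (pmf_of_set A) (pmf_of_set B) = pmf_of_set (A \<times> B)"
proof (rule pmf_eqI)
  fix z show "pmf (pair_pmf (pmf_of_set A) (pmf_of_set B)) z = pmf (pmf_of_set (A \<times> B)) z"
    using assms by (cases z) (simp add: pmf_pair indicator_def card_cartesian_product)
qed

lemma quotient_kernel:
  assumes "\<And>x y. (x, y) \<in> R \<longleftrightarrow> x \<in> X \<and> y \<in> X \<and> f x = f y"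
  shows "X // R = (\<lambda>h. {x \<in> X. f x = h}) ` f ` X"
proof -
  have "R `` {x} = {y \<in> X. f y = f x}" if "x \<in> X" for x using assms that by auto
  then show ?thesis unfolding quotient_def by (auto simp: image_iff)
qed

definition unrooted_class :: "nat \<Rightarrow> nat \<Rightarrow> nat set set \<Rightarrow> nat pair_pre_digraph set" where
  "unrooted_class n l H = {G \<in> unrooted_binary_trees n. unrooted_clusters n l G = H}"

definition rooted_class :: "nat set \<Rightarrow> nat set set \<Rightarrow> rooted_graph set" where
  "rooted_class S h = {X \<in> rooted_binary_trees S. rooted_clusters S X = h}"

lemma unrooted_class_nonempty:
  "binary_hierarchy ({1..n} - {l}) H \<Longrightarrow> l \<in> {1..n} \<Longrightarrow> \<exists>G. G \<in> unrooted_class n l H"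
  using unrooted_clusters_surj unfolding unrooted_class_def by blast

lemma bij_betw_unrooted_class:
  assumes l: "l \<in> {1..n}"
  shows "bij_betw (unrooted_class n l) {H. binary_hierarchy ({1..n} - {l}) H} (unrooted_classes n)"
  unfolding bij_betw_def
proof
  show "inj_on (unrooted_class n l) {H. binary_hierarchy ({1..n} - {l}) H}"
  proof (rule inj_onI)
    fix H H' assume "H \<in> {H. binary_hierarchy ({1..n} - {l}) H}" and eq: "unrooted_class n l H = unrooted_class n l H'"
    then obtain G where "G \<in> unrooted_class n l H" using unrooted_class_nonempty l by blast
    moreover have "G \<in> unrooted_class n l H'" using calculation eq by simp
    ultimately show "H = H'" unfolding unrooted_class_def by blast
  qed
  have "unrooted_clusters n l ` unrooted_binary_trees n = {H. binary_hierarchy ({1..n} - {l}) H}"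
    using binary_hierarchy_unrooted_clusters l unrooted_clusters_surj by blast
  then show "unrooted_class n l ` {H. binary_hierarchy ({1..n} - {l}) H} = unrooted_classes n"
    unfolding unrooted_classes_def unrooted_class_def
    using quotient_kernel[of "unrooted_iso n", OF unrooted_iso_iff[OF l]] by simp
qed

lemma finite_unrooted_classes: "1 \<le> n \<Longrightarrow> finite (unrooted_classes n)"
  using bij_betw_finite[OF bij_betw_unrooted_class[of 1 n]] finite_binary_hierarchies[of "{1..n} - {1}"]
  by simp

lemma card_unrooted_classes:
  assumes "2 \<le> n"
  shows "card (unrooted_classes n) = double_fact (2 * n - 5)"
proof -
  have "{1..n} - {1} \<noteq> {}" using assms by (auto simp: set_eq_iff intro!: exI[of _ 2])
  moreover have "card ({1..n} - {1}) = n - 1" using assms by simp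
  moreover have "2 * (n - 1) - 3 = 2 * n - 5" by simp
  ultimately show ?thesis
    using bij_betw_same_card[OF bij_betw_unrooted_class[of 1 n]] card_binary_hierarchies[of "{1..n} - {1}"] assms
    by simp
qed

lemma rooted_classes_eq: "rooted_classes S = rooted_class S ` rooted_clusters S ` rooted_binary_trees S"
  unfolding rooted_classes_def rooted_class_def
  by (rule quotient_kernel[OF rooted_iso_iff])

lemma binary_hierarchy_rooted_clusters:
  "X \<in> rooted_binary_trees S \<Longrightarrow> binary_hierarchy S (rooted_clusters S X)"
  by (cases X) (auto simp: rooted_binary_trees_iff rooted_clusters_def
      intro!: binary_tree_order.binary_hierarchy_clusters)

lemma induced_class_unrooted_class:
  assumes H: "binary_hierarchy ({1..n} - {l}) H" and l: "l \<in> {1..n}"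
    and S: "S \<subseteq> {1..n} - {l}" "1 < card S"
  shows "induced_class l S (unrooted_class n l H) = rooted_class S (restrict_hierarchy S H)"
    and "restrict_hierarchy S H \<in> rooted_clusters S ` rooted_binary_trees S"
proof -
  obtain G where G: "G \<in> unrooted_class n l H" using unrooted_class_nonempty[OF H l] by blast
  have ind: "induced_tree l S G \<in> rooted_binary_trees S"
    "rooted_clusters S (induced_tree l S G) = restrict_hierarchy S H" if "G \<in> unrooted_class n l H" for G
    using induced_tree_clusters[OF _ l S, of G] that by (auto simp: unrooted_class_def)
  then have "rooted_iso S `` {induced_tree l S G} = rooted_class S (restrict_hierarchy S H)"
    if "G \<in> unrooted_class n l H" for G
    using that by (auto simp: rooted_iso_iff rooted_class_def)
  then show "induced_class l S (unrooted_class n l H) = rooted_class S (restrict_hierarchy S H)"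
    unfolding induced_class_def using G by auto
  show "restrict_hierarchy S H \<in> rooted_clusters S ` rooted_binary_trees S"
    using ind[OF G] by (metis image_eqI)
qed

lemma induced_class_in_rooted_classes:
  assumes T: "T \<in> unrooted_classes n" and l: "l \<in> {1..n}" and S: "S \<subseteq> {1..n} - {l}" "1 < card S"
  shows "induced_class l S T \<in> rooted_classes S"
proof -
  obtain H where "binary_hierarchy ({1..n} - {l}) H" "T = unrooted_class n l H"
    using T bij_betw_imp_surj_on[OF bij_betw_unrooted_class[OF l]] by blast
  then show ?thesis
    using induced_class_unrooted_class[OF _ l S, of H] unfolding rooted_classes_eq by blast
qed

text \<open>
  Under the correspondence between classes and hierarchies the trees that induce \<open>\<tau>\<close> become the
  hierarchies on \<open>{1..n} - {l}\<close> that restrict to the hierarchy of \<open>\<tau>\<close>.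
\<close>

lemma card_inducing_classes:
  assumes \<tau>: "\<tau> \<in> rooted_classes S" and l: "l \<in> {1..n}" and S: "S \<subseteq> {1..n} - {l}" "1 < card S"
  shows "card {T \<in> unrooted_classes n. induced_class l S T = \<tau>} * double_fact (2 * card S - 3) =
    double_fact (2 * n - 5)"
proof -
  obtain X where X: "X \<in> rooted_binary_trees S" "\<tau> = rooted_class S (rooted_clusters S X)"
    using \<tau> unfolding rooted_classes_eq by blast
  define h where "h = rooted_clusters S X"
  have h: "binary_hierarchy S h" unfolding h_def by (rule binary_hierarchy_rooted_clusters[OF X(1)])
  let ?A = "{1..n} - {l}"
  let ?E = "{H. binary_hierarchy ?A H \<and> restrict_hierarchy S H = h}"
  have eq: "rooted_class S (restrict_hierarchy S H) = \<tau> \<longleftrightarrow> restrict_hierarchy S H = h" for H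
  proof
    assume "rooted_class S (restrict_hierarchy S H) = \<tau>"
    moreover have "X \<in> \<tau>" using X by (simp add: rooted_class_def)
    ultimately show "restrict_hierarchy S H = h" unfolding rooted_class_def h_def by blast
  qed (simp add: X(2) h_def)
  have img: "unrooted_classes n = unrooted_class n l ` {H. binary_hierarchy ?A H}"
    using bij_betw_imp_surj_on[OF bij_betw_unrooted_class[OF l]] by simp
  have "{T \<in> unrooted_classes n. induced_class l S T = \<tau>} = unrooted_class n l ` ?E"
  proof -
    have "induced_class l S (unrooted_class n l H) = \<tau> \<longleftrightarrow> restrict_hierarchy S H = h"
      if "binary_hierarchy ?A H" for H
      unfolding induced_class_unrooted_class(1)[OF that l S] by (rule eq)
    then show ?thesis unfolding img by blast
  qed
  moreover have "inj_on (unrooted_class n l) ?E"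
    by (rule inj_on_subset[OF bij_betw_imp_inj_on[OF bij_betw_unrooted_class[OF l]]]) auto
  ultimately have "card {T \<in> unrooted_classes n. induced_class l S T = \<tau>} = card ?E"
    by (simp add: card_image)
  moreover have "card ?A = n - 1" using l by simp
  moreover have "2 * (n - 1) - 3 = 2 * n - 5" by simp
  moreover have "S \<noteq> {}" using S(2) by auto
  ultimately show ?thesis using card_hierarchy_extensions[OF _ S(1) _ h] by simp
qed

theorem lemma2p1:
  fixes a n :: nat and ls :: "nat set \<Rightarrow> nat"
  assumes "1 < a" and "a < n"
    and "\<And>S. S \<subseteq> {1..n} \<Longrightarrow> 1 < card S \<Longrightarrow> card S < n \<Longrightarrow> ls S \<in> {1..n} - S"
  shows "measure_pmf.expectation (random_tree_pair n)
           (\<lambda>(T', T''). real (num_common_subtrees ls n a T' T''))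
           = real (n choose a) / real (double_fact (2 * a - 3))
       \<and> (\<forall>S. S \<subseteq> {1..n} \<and> card S = a \<longrightarrow>
            (\<forall>\<tau> \<in> rooted_classes S.
               real (card {T \<in> unrooted_classes n. induced_class (ls S) S T = \<tau>})
                 = real (double_fact (2 * n - 5)) / real (double_fact (2 * a - 3))))"
proof
  let ?C = "unrooted_classes n" and ?D = "double_fact (2 * a - 3)"
  let ?Ss = "{S. S \<subseteq> {1..n} \<and> card S = a}"
  have ls: "ls S \<in> {1..n}" "S \<subseteq> {1..n} - {ls S}" "1 < card S" if "S \<in> ?Ss" for S
    using assms(3)[of S] that assms(1,2) by auto
  have part2: "real (card {T \<in> ?C. induced_class (ls S) S T = \<tau>}) = real (double_fact (2 * n - 5)) / real ?D"
    if "S \<in> ?Ss" "\<tau> \<in> rooted_classes S" for S \<tau>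
  proof -
    have "card {T \<in> ?C. induced_class (ls S) S T = \<tau>} * ?D = double_fact (2 * n - 5)"
      using card_inducing_classes[OF that(2) ls[OF that(1)]] that(1) by simp
    then have "real (card {T \<in> ?C. induced_class (ls S) S T = \<tau>}) * real ?D = real (double_fact (2 * n - 5))"
      by (simp only: of_nat_mult[symmetric])
    then show ?thesis using double_fact_pos[of "2 * a - 3"] by (simp add: eq_divide_eq)
  qed
  then show "\<forall>S. S \<subseteq> {1..n} \<and> card S = a \<longrightarrow> (\<forall>\<tau> \<in> rooted_classes S.
      real (card {T \<in> ?C. induced_class (ls S) S T = \<tau>}) = real (double_fact (2 * n - 5)) / real ?D)"
    by blast
  have card_C: "card ?C = double_fact (2 * n - 5)" using assms by (intro card_unrooted_classes) simp
  have fin_C: "finite ?C" using assms by (intro finite_unrooted_classes) simp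
  have C_pos: "0 < card ?C" unfolding card_C by (rule double_fact_pos)
  then have ne_C: "?C \<noteq> {}" by auto
  have fin_S: "finite ?Ss" by simp
  have "(\<Sum>T'\<in>?C. \<Sum>T''\<in>?C. real (num_common_subtrees ls n a T' T'')) =
      (\<Sum>T'\<in>?C. \<Sum>T''\<in>?C. \<Sum>S\<in>?Ss. if induced_class (ls S) S T' = induced_class (ls S) S T'' then 1 else 0)"
  proof (intro sum.cong refl)
    fix T' T'' :: "nat pair_pre_digraph set"
    have "{S. S \<subseteq> {1..n} \<and> card S = a \<and> induced_class (ls S) S T' = induced_class (ls S) S T''} =
        ?Ss \<inter> {S. induced_class (ls S) S T' = induced_class (ls S) S T''}" by blast
    then show "real (num_common_subtrees ls n a T' T'') =
        (\<Sum>S\<in>?Ss. if induced_class (ls S) S T' = induced_class (ls S) S T'' then 1 else 0)"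
      unfolding num_common_subtrees_def using fin_S by (simp add: sum.If_cases)
  qed
  also have "\<dots> = (\<Sum>S\<in>?Ss. \<Sum>T'\<in>?C. \<Sum>T''\<in>?C.
      if induced_class (ls S) S T' = induced_class (ls S) S T'' then 1 else 0)"
    by (simp only: sum.swap[of _ ?Ss ?C])
  \<comment> \<open>For fixed \<open>S\<close> and \<open>T'\<close> the trees \<open>T''\<close> that agree with \<open>T'\<close> on \<open>S\<close> are those that induce one
    given rooted tree.\<close>
  also have "\<dots> = (\<Sum>S\<in>?Ss. \<Sum>T'\<in>?C. real (card ?C) / real ?D)"
  proof (intro sum.cong refl)
    fix S T' assume S: "S \<in> ?Ss" and T': "T' \<in> ?C"
    have "?C \<inter> {T''. induced_class (ls S) S T' = induced_class (ls S) S T''} =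
        {T \<in> ?C. induced_class (ls S) S T = induced_class (ls S) S T'}" by auto
    then have "(\<Sum>T''\<in>?C. if induced_class (ls S) S T' = induced_class (ls S) S T'' then 1 else 0) =
        real (card {T \<in> ?C. induced_class (ls S) S T = induced_class (ls S) S T'})"
      using fin_C by (simp add: sum.If_cases)
    also have "\<dots> = real (card ?C) / real ?D"
      using part2[OF S induced_class_in_rooted_classes[OF T' ls[OF S]]] card_C by simp
    finally show "(\<Sum>T''\<in>?C. if induced_class (ls S) S T' = induced_class (ls S) S T'' then 1 else 0) =
        real (card ?C) / real ?D" .
  qed
  also have "\<dots> = real (n choose a) * (real (card ?C) * (real (card ?C) / real ?D))"
    using n_subsets[of "{1..n}" a] by simp
  finally have sum: "(\<Sum>T'\<in>?C. \<Sum>T''\<in>?C. real (num_common_subtrees ls n a T' T'')) =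
      real (n choose a) * (real (card ?C) * (real (card ?C) / real ?D))" .
  have pair: "random_tree_pair n = pmf_of_set (?C \<times> ?C)"
    unfolding random_tree_pair_def using fin_C ne_C by (intro pair_pmf_of_set)
  show "measure_pmf.expectation (random_tree_pair n) (\<lambda>(T', T''). real (num_common_subtrees ls n a T' T'')) =
      real (n choose a) / real ?D"
    unfolding pair using fin_C ne_C C_pos sum
    by (simp add: integral_pmf_of_set sum.cartesian_product[symmetric] card_cartesian_product field_simps)
qed

end
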